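(* Let $R$ be a ring and let $M$ be a right $R$-module which has a flat $\delta$-cover. Then every generalized projective $\delta$-cover $g:P\to M$ of $M$ is a projective $\delta$-cover of $M$.
   Context: Rings are associative with identity; modules are unitary right modules. A submodule $N$ of a module $M$ is $\delta$-small in $M$, written $N\ll_\delta M$, if $N+K\neq M$ for every proper submodule $K$ of $M$ with $M/K$ singular (a module is singular if each of its elements is annihilated by some essential right ideal of $R$). $\delta(M)$ denotes the sum of all $\delta$-small submodules of $M$. A $\delta$-cover of $M$ is an epimorphism $f:P\to M$ with $\operatorname{Ker}(f)\ll_\delta P$; it is called a flat (resp. projective) $\delta$-cover if $P$ is a flat (resp. projective) module. A generalized projective $\delta$-cover of $M$ is an epimorphism $f:P\to M$ with $P$ projective and $\operatorname{Ker}(f)\subseteq\delta(P)$. *)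

theory Defs
  imports "HOL-Algebra.Free_Abelian_Groups" "HOL-Algebra.AbelCoset" "HOL-Algebra.Module"
    "HOL-Algebra.Generated_Groups"
begin

section \<open>Left and right modules over a ring\<close>

text \<open>
  The locale \<^locale>\<open>module\<close> of HOL-Algebra asks for a commutative ring of scalars. Over
  an arbitrary ring \<open>R\<close> the same record type is used here for both sides: the ring argument
  of \<open>\<odot>\<close> is written first, so for a right module \<open>a \<odot> x\<close> stands for \<open>x a\<close>, and the two
  associativity laws below tell left from right. The fields \<^const>\<open>mult\<close> and
  \<^const>\<open>one\<close> of a module record are never used. Submodules are those of the library
  locale \<^locale>\<open>submodule\<close>, which does not depend on the side.
\<close>

locale right_module = R?: ring R + M?: abelian_group M
  for R :: "('a, 'x) ring_scheme" (structure) and M :: "('a, 'm, 'y) module_scheme" (structure) +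
  assumes smult_closed [simp, intro]:
      "\<lbrakk>a \<in> carrier R; x \<in> carrier M\<rbrakk> \<Longrightarrow> a \<odot>\<^bsub>M\<^esub> x \<in> carrier M"
    and smult_l_distr:
      "\<lbrakk>a \<in> carrier R; b \<in> carrier R; x \<in> carrier M\<rbrakk> \<Longrightarrow>
        (a \<oplus> b) \<odot>\<^bsub>M\<^esub> x = a \<odot>\<^bsub>M\<^esub> x \<oplus>\<^bsub>M\<^esub> b \<odot>\<^bsub>M\<^esub> x"
    and smult_r_distr:
      "\<lbrakk>a \<in> carrier R; x \<in> carrier M; y \<in> carrier M\<rbrakk> \<Longrightarrow>
        a \<odot>\<^bsub>M\<^esub> (x \<oplus>\<^bsub>M\<^esub> y) = a \<odot>\<^bsub>M\<^esub> x \<oplus>\<^bsub>M\<^esub> a \<odot>\<^bsub>M\<^esub> y"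
    and smult_assoc_right:
      "\<lbrakk>a \<in> carrier R; b \<in> carrier R; x \<in> carrier M\<rbrakk> \<Longrightarrow>
        (a \<otimes> b) \<odot>\<^bsub>M\<^esub> x = b \<odot>\<^bsub>M\<^esub> (a \<odot>\<^bsub>M\<^esub> x)"
    and smult_one [simp]: "x \<in> carrier M \<Longrightarrow> \<one> \<odot>\<^bsub>M\<^esub> x = x"

locale left_module = R?: ring R + M?: abelian_group M
  for R :: "('a, 'x) ring_scheme" (structure) and M :: "('a, 'm, 'y) module_scheme" (structure) +
  assumes smult_closed [simp, intro]:
      "\<lbrakk>a \<in> carrier R; x \<in> carrier M\<rbrakk> \<Longrightarrow> a \<odot>\<^bsub>M\<^esub> x \<in> carrier M"
    and smult_l_distr:
      "\<lbrakk>a \<in> carrier R; b \<in> carrier R; x \<in> carrier M\<rbrakk> \<Longrightarrow>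
        (a \<oplus> b) \<odot>\<^bsub>M\<^esub> x = a \<odot>\<^bsub>M\<^esub> x \<oplus>\<^bsub>M\<^esub> b \<odot>\<^bsub>M\<^esub> x"
    and smult_r_distr:
      "\<lbrakk>a \<in> carrier R; x \<in> carrier M; y \<in> carrier M\<rbrakk> \<Longrightarrow>
        a \<odot>\<^bsub>M\<^esub> (x \<oplus>\<^bsub>M\<^esub> y) = a \<odot>\<^bsub>M\<^esub> x \<oplus>\<^bsub>M\<^esub> a \<odot>\<^bsub>M\<^esub> y"
    and smult_assoc_left:
      "\<lbrakk>a \<in> carrier R; b \<in> carrier R; x \<in> carrier M\<rbrakk> \<Longrightarrow>
        (a \<otimes> b) \<odot>\<^bsub>M\<^esub> x = a \<odot>\<^bsub>M\<^esub> (b \<odot>\<^bsub>M\<^esub> x)"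
    and smult_one [simp]: "x \<in> carrier M \<Longrightarrow> \<one> \<odot>\<^bsub>M\<^esub> x = x"

definition mod_hom ::
    "('r, 'x) ring_scheme \<Rightarrow> ('r, 'm, 'y) module_scheme \<Rightarrow> ('r, 'n, 'z) module_scheme \<Rightarrow> ('m \<Rightarrow> 'n) set"
  where "mod_hom R M N =
    {h \<in> carrier M \<rightarrow> carrier N.
       (\<forall>x\<in>carrier M. \<forall>y\<in>carrier M. h (x \<oplus>\<^bsub>M\<^esub> y) = h x \<oplus>\<^bsub>N\<^esub> h y) \<and>
       (\<forall>a\<in>carrier R. \<forall>x\<in>carrier M. h (a \<odot>\<^bsub>M\<^esub> x) = a \<odot>\<^bsub>N\<^esub> h x)}"

definition mod_epi ::
    "('r, 'x) ring_scheme \<Rightarrow> ('r, 'm, 'y) module_scheme \<Rightarrow> ('r, 'n, 'z) module_scheme \<Rightarrow> ('m \<Rightarrow> 'n) set"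
  where "mod_epi R M N = {h \<in> mod_hom R M N. h ` carrier M = carrier N}"

text \<open>The scalar action on cosets is \<open>(K + x) a = K + x a\<close>; see lemma \<open>quot_module\<close>.\<close>

definition quot_module :: "('r, 'm, 'y) module_scheme \<Rightarrow> 'm set \<Rightarrow> ('r, 'm set) module"
  where "quot_module M K =
    \<lparr>carrier = a_rcosets\<^bsub>M\<^esub> K, mult = (\<lambda>_ _. undefined), one = undefined,
     zero = K, add = set_add M, smult = (\<lambda>a X. \<Union>x\<in>X. K +>\<^bsub>M\<^esub> (a \<odot>\<^bsub>M\<^esub> x))\<rparr>"


section \<open>Singular modules and \<open>\<delta>\<close>-small submodules\<close>

definition right_ideal :: "'r set \<Rightarrow> ('r, 'x) ring_scheme \<Rightarrow> bool"
  where "right_ideal I R \<longleftrightarrow>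
    additive_subgroup I R \<and> (\<forall>a\<in>I. \<forall>r\<in>carrier R. a \<otimes>\<^bsub>R\<^esub> r \<in> I)"

definition essential_right_ideal :: "'r set \<Rightarrow> ('r, 'x) ring_scheme \<Rightarrow> bool"
  where "essential_right_ideal I R \<longleftrightarrow>
    right_ideal I R \<and> (\<forall>J. right_ideal J R \<and> J \<noteq> {\<zero>\<^bsub>R\<^esub>} \<longrightarrow> I \<inter> J \<noteq> {\<zero>\<^bsub>R\<^esub>})"

definition singular_module :: "('r, 'x) ring_scheme \<Rightarrow> ('r, 'm, 'y) module_scheme \<Rightarrow> bool"
  where "singular_module R M \<longleftrightarrow>
    (\<forall>x\<in>carrier M. \<exists>I. essential_right_ideal I R \<and> (\<forall>a\<in>I. a \<odot>\<^bsub>M\<^esub> x = \<zero>\<^bsub>M\<^esub>))"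

definition delta_small :: "('r, 'x) ring_scheme \<Rightarrow> ('r, 'm, 'y) module_scheme \<Rightarrow> 'm set \<Rightarrow> bool"
  where "delta_small R M N \<longleftrightarrow>
    submodule N R M \<and>
    (\<forall>K. submodule K R M \<and> K \<noteq> carrier M \<and> singular_module R (quot_module M K)
       \<longrightarrow> N <+>\<^bsub>M\<^esub> K \<noteq> carrier M)"

definition sum_of_submodules :: "('r, 'm, 'y) module_scheme \<Rightarrow> 'm set set \<Rightarrow> 'm set"
  where "sum_of_submodules M \<N> =
    {finsum M x \<F> |x \<F>. finite \<F> \<and> \<F> \<subseteq> \<N> \<and> (\<forall>N\<in>\<F>. x N \<in> N)}"

definition delta_submodule :: "('r, 'x) ring_scheme \<Rightarrow> ('r, 'm, 'y) module_scheme \<Rightarrow> 'm set"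
  where "delta_submodule R M = sum_of_submodules M {N. delta_small R M N}"


section \<open>Projective modules\<close>

definition lifts_along ::
    "('r, 'x) ring_scheme \<Rightarrow> ('r, 'p, 'y) module_scheme \<Rightarrow>
     ('r, 'a, 'z) module_scheme \<Rightarrow> ('r, 'b, 'w) module_scheme \<Rightarrow> bool"
  where "lifts_along R P X Y \<longleftrightarrow>
    (\<forall>f\<in>mod_epi R X Y. \<forall>g\<in>mod_hom R P Y. \<exists>h\<in>mod_hom R P X. \<forall>p\<in>carrier P. f (h p) = g p)"

text \<open>
  A formula of HOL cannot quantify over types, so the test modules \<open>X\<close> and \<open>Y\<close> are drawn from
  two types that are large enough: the type \<open>'p \<Rightarrow> 'r\<close> has room for the free module on the
  carrier of \<open>P\<close>. Theorem \<open>projective_module_lifts\<close> below gives the lifting property for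
  all right modules \<open>X\<close>, \<open>Y\<close>, whatever their types.
\<close>

definition projective_module :: "('r, 'x) ring_scheme \<Rightarrow> ('r, 'p, 'y) module_scheme \<Rightarrow> bool"
  where "projective_module R P \<longleftrightarrow>
    right_module R P \<and>
    (\<forall>(X :: ('r, 'p \<Rightarrow> 'r) module) (Y :: ('r, 'p) module).
       right_module R X \<and> right_module R Y \<longrightarrow> lifts_along R P X Y)"


section \<open>Tensor products and flat modules\<close>

text \<open>
  \<open>F \<otimes>\<^sub>R A\<close> is the free abelian group on \<open>F \<times> A\<close> modulo the subgroup generated by the
  bilinear and balanced relations; in the third family \<open>r \<odot> x\<close> is \<open>x r\<close>, as \<open>F\<close> is a right module.
\<close>

definition tensor_relations ::
    "('r, 'x) ring_scheme \<Rightarrow> ('r, 'f, 'y) module_scheme \<Rightarrow> ('r, 'a, 'z) module_scheme \<Rightarrow>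
     ('f \<times> 'a \<Rightarrow>\<^sub>0 int) set"
  where "tensor_relations R F A =
    {frag_of (x \<oplus>\<^bsub>F\<^esub> y, a) - frag_of (x, a) - frag_of (y, a) |x y a.
       x \<in> carrier F \<and> y \<in> carrier F \<and> a \<in> carrier A} \<union>
    {frag_of (x, a \<oplus>\<^bsub>A\<^esub> b) - frag_of (x, a) - frag_of (x, b) |x a b.
       x \<in> carrier F \<and> a \<in> carrier A \<and> b \<in> carrier A} \<union>
    {frag_of (r \<odot>\<^bsub>F\<^esub> x, a) - frag_of (x, r \<odot>\<^bsub>A\<^esub> a) |r x a.
       r \<in> carrier R \<and> x \<in> carrier F \<and> a \<in> carrier A}"

abbreviation tensor_free ::
    "('r, 'f, 'y) module_scheme \<Rightarrow> ('r, 'a, 'z) module_scheme \<Rightarrow> ('f \<times> 'a \<Rightarrow>\<^sub>0 int) monoid"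
  where "tensor_free F A \<equiv> free_Abelian_group (carrier F \<times> carrier A)"

definition tensor_rel ::
    "('r, 'x) ring_scheme \<Rightarrow> ('r, 'f, 'y) module_scheme \<Rightarrow> ('r, 'a, 'z) module_scheme \<Rightarrow>
     ('f \<times> 'a \<Rightarrow>\<^sub>0 int) set"
  where "tensor_rel R F A = generate (tensor_free F A) (tensor_relations R F A)"

definition tensor_product ::
    "('r, 'x) ring_scheme \<Rightarrow> ('r, 'f, 'y) module_scheme \<Rightarrow> ('r, 'a, 'z) module_scheme \<Rightarrow>
     ('f \<times> 'a \<Rightarrow>\<^sub>0 int) set monoid"
  where "tensor_product R F A = tensor_free F A Mod tensor_rel R F A"

definition frag_map :: "('a \<Rightarrow> 'b) \<Rightarrow> ('f \<times> 'a \<Rightarrow>\<^sub>0 int) \<Rightarrow> ('f \<times> 'b \<Rightarrow>\<^sub>0 int)"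
  where "frag_map u = frag_extend (\<lambda>(x, a). frag_of (x, u a))"

text \<open>
  The map \<open>F \<otimes> A \<rightarrow> F \<otimes> B\<close>, \<open>x \<otimes> a \<mapsto> x \<otimes> u a\<close>, on cosets; see
  \<open>tensor_map_coset\<close> and \<open>tensor_map_hom\<close>.
\<close>

definition tensor_map ::
    "('r, 'x) ring_scheme \<Rightarrow> ('r, 'f, 'y) module_scheme \<Rightarrow> ('r, 'b, 'z) module_scheme \<Rightarrow>
     ('a \<Rightarrow> 'b) \<Rightarrow> ('f \<times> 'a \<Rightarrow>\<^sub>0 int) set \<Rightarrow> ('f \<times> 'b \<Rightarrow>\<^sub>0 int) set"
  where "tensor_map R F B u X = tensor_rel R F B <#>\<^bsub>tensor_free F B\<^esub> (frag_map u ` X)"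

text \<open>
  Again the test modules \<open>A\<close> and \<open>B\<close> must come from a fixed type. Every finitely generated left
  module has an isomorphic copy in the type below (an element is represented by the set of its
  coordinate sequences), and this is enough: theorem \<open>flat_module_tensor_inj\<close> gives
  the injectivity for all left modules \<open>A\<close>, \<open>B\<close>, whatever their types.
\<close>

definition flat_module :: "('r, 'x) ring_scheme \<Rightarrow> ('r, 'f, 'y) module_scheme \<Rightarrow> bool"
  where "flat_module R F \<longleftrightarrow>
    right_module R F \<and>
    (\<forall>(A :: ('r, (nat \<Rightarrow> 'r) set) module) (B :: ('r, (nat \<Rightarrow> 'r) set) module) u.
       left_module R A \<and> left_module R B \<and> u \<in> mod_hom R A B \<and> inj_on u (carrier A)
       \<longrightarrow> inj_on (tensor_map R F B u) (carrier (tensor_product R F A)))"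


section \<open>\<open>\<delta>\<close>-covers\<close>

definition delta_cover ::
    "('r, 'x) ring_scheme \<Rightarrow> ('r, 'p, 'y) module_scheme \<Rightarrow> ('r, 'm, 'z) module_scheme \<Rightarrow>
     ('p \<Rightarrow> 'm) \<Rightarrow> bool"
  where "delta_cover R P M f \<longleftrightarrow>
    right_module R P \<and> right_module R M \<and> f \<in> mod_epi R P M \<and> delta_small R P (a_kernel P M f)"

definition flat_delta_cover ::
    "('r, 'x) ring_scheme \<Rightarrow> ('r, 'p, 'y) module_scheme \<Rightarrow> ('r, 'm, 'z) module_scheme \<Rightarrow>
     ('p \<Rightarrow> 'm) \<Rightarrow> bool"
  where "flat_delta_cover R F M f \<longleftrightarrow> flat_module R F \<and> delta_cover R F M f"

definition projective_delta_cover ::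
    "('r, 'x) ring_scheme \<Rightarrow> ('r, 'p, 'y) module_scheme \<Rightarrow> ('r, 'm, 'z) module_scheme \<Rightarrow>
     ('p \<Rightarrow> 'm) \<Rightarrow> bool"
  where "projective_delta_cover R P M f \<longleftrightarrow> projective_module R P \<and> delta_cover R P M f"

definition generalized_projective_delta_cover ::
    "('r, 'x) ring_scheme \<Rightarrow> ('r, 'p, 'y) module_scheme \<Rightarrow> ('r, 'm, 'z) module_scheme \<Rightarrow>
     ('p \<Rightarrow> 'm) \<Rightarrow> bool"
  where "generalized_projective_delta_cover R P M f \<longleftrightarrow>
    projective_module R P \<and> right_module R M \<and> f \<in> mod_epi R P M \<and>
    a_kernel P M f \<subseteq> delta_submodule R P"

section \<open>Quotient modules are modules\<close>

lemma (in right_module) quot_module: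
  assumes K: "submodule K R M"
  shows "right_module R (quot_module M K)"
    and "\<And>a x. a \<in> carrier R \<Longrightarrow> x \<in> carrier M \<Longrightarrow>
      a \<odot>\<^bsub>quot_module M K\<^esub> (K +>\<^bsub>M\<^esub> x) = K +>\<^bsub>M\<^esub> (a \<odot>\<^bsub>M\<^esub> x)"
proof -
  let ?Q = "quot_module M K"
  interpret K: submodule K R M by fact
  interpret Ka: abelian_subgroup K M
    by (intro abelian_subgroupI3 additive_subgroupI K.subgroup_axioms M.abelian_group_axioms)
  have car: "x \<in> carrier ?Q \<longleftrightarrow> (\<exists>m\<in>carrier M. x = K +>\<^bsub>M\<^esub> m)" for x
    by (auto simp: quot_module_def A_RCOSETS_def')
  have add: "(K +>\<^bsub>M\<^esub> x) \<oplus>\<^bsub>?Q\<^esub> (K +>\<^bsub>M\<^esub> y) = K +>\<^bsub>M\<^esub> (x \<oplus>\<^bsub>M\<^esub> y)"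
    if "x \<in> carrier M" "y \<in> carrier M" for x y
    using Ka.a_rcos_sum[OF that] by (simp add: quot_module_def)
  have zero: "\<zero>\<^bsub>?Q\<^esub> = K +>\<^bsub>M\<^esub> \<zero>\<^bsub>M\<^esub>"
    using M.a_coset_add_zero[OF K.subset[simplified]] by (simp add: quot_module_def)
  show sm: "a \<odot>\<^bsub>?Q\<^esub> (K +>\<^bsub>M\<^esub> x) = K +>\<^bsub>M\<^esub> (a \<odot>\<^bsub>M\<^esub> x)"
    if a: "a \<in> carrier R" and x: "x \<in> carrier M" for a x
  proof -
    have "K +>\<^bsub>M\<^esub> (a \<odot>\<^bsub>M\<^esub> y) = K +>\<^bsub>M\<^esub> (a \<odot>\<^bsub>M\<^esub> x)" if "y \<in> K +>\<^bsub>M\<^esub> x" for y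
    proof -
      obtain k where k: "k \<in> K" "y = k \<oplus>\<^bsub>M\<^esub> x" using \<open>y \<in> K +>\<^bsub>M\<^esub> x\<close> by (auto simp: a_r_coset_def')
      have "k \<in> carrier M" using k(1) K.subset by auto
      then have "a \<odot>\<^bsub>M\<^esub> y = a \<odot>\<^bsub>M\<^esub> k \<oplus>\<^bsub>M\<^esub> a \<odot>\<^bsub>M\<^esub> x" using a x by (simp add: k(2) smult_r_distr)
      moreover have "a \<odot>\<^bsub>M\<^esub> k \<in> K" using a k(1) by (rule K.smult_closed)
      ultimately have "a \<odot>\<^bsub>M\<^esub> y \<in> K +>\<^bsub>M\<^esub> (a \<odot>\<^bsub>M\<^esub> x)" by (auto simp: a_r_coset_def')
      then show ?thesis using Ka.a_repr_independence'[of "a \<odot>\<^bsub>M\<^esub> y" "a \<odot>\<^bsub>M\<^esub> x"] a x by simp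
    qed
    note const = this
    have "(\<Union>y\<in>K +>\<^bsub>M\<^esub> x. K +>\<^bsub>M\<^esub> (a \<odot>\<^bsub>M\<^esub> y)) = K +>\<^bsub>M\<^esub> (a \<odot>\<^bsub>M\<^esub> x)"
      by (rule UN_constant_eq[where f = "\<lambda>y. K +>\<^bsub>M\<^esub> (a \<odot>\<^bsub>M\<^esub> y)",
            OF Ka.a_rcos_self[OF x]])
        (intro ballI const)
    then show ?thesis by (simp add: quot_module_def)
  qed
  have "abelian_group ?Q"
  proof (rule abelian_groupI)
    fix x assume "x \<in> carrier ?Q"
    then obtain m where m: "m \<in> carrier M" "x = K +>\<^bsub>M\<^esub> m" by (auto simp: car)
    then show "\<exists>y\<in>carrier ?Q. y \<oplus>\<^bsub>?Q\<^esub> x = \<zero>\<^bsub>?Q\<^esub>"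
      by (intro bexI[of _ "K +>\<^bsub>M\<^esub> (\<ominus>\<^bsub>M\<^esub> m)"]) (auto simp: car add zero M.l_neg)
  next
    show "\<zero>\<^bsub>?Q\<^esub> \<in> carrier ?Q" unfolding car zero by blast
  next
    fix x assume "x \<in> carrier ?Q"
    then show "\<zero>\<^bsub>?Q\<^esub> \<oplus>\<^bsub>?Q\<^esub> x = x" by (auto simp: car add zero)
  qed (auto simp: car add M.a_ac)
  then show "right_module R ?Q"
    by (intro right_module.intro right_module_axioms.intro R.ring_axioms)
      (auto simp: car add sm smult_l_distr smult_r_distr smult_assoc_right)
qed


section \<open>Independence of the test types\<close>

subsection \<open>Tensor products\<close>

lemma mod_homD:
  assumes "h \<in> mod_hom R M N"
  shows "\<And>x. x \<in> carrier M \<Longrightarrow> h x \<in> carrier N"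
    and "\<And>x y. x \<in> carrier M \<Longrightarrow> y \<in> carrier M \<Longrightarrow> h (x \<oplus>\<^bsub>M\<^esub> y) = h x \<oplus>\<^bsub>N\<^esub> h y"
    and "\<And>a x. a \<in> carrier R \<Longrightarrow> x \<in> carrier M \<Longrightarrow> h (a \<odot>\<^bsub>M\<^esub> x) = a \<odot>\<^bsub>N\<^esub> h x"
  using assms by (auto simp: mod_hom_def)

lemma frag_map_simps [simp]:
  "frag_map u 0 = 0"
  "frag_map u (frag_of (x, a)) = frag_of (x, u a)"
  "frag_map u (z + w) = frag_map u z + frag_map u w"
  "frag_map u (z - w) = frag_map u z - frag_map u w"
  "frag_map u (- z) = - frag_map u z"
  by (simp_all add: frag_map_def frag_extend_add frag_extend_diff frag_extend_minus)

lemma frag_map_closed: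
  assumes "Poly_Mapping.keys z \<subseteq> S \<times> A" "\<And>a. a \<in> A \<Longrightarrow> u a \<in> B"
  shows "Poly_Mapping.keys (frag_map u z) \<subseteq> S \<times> B"
proof -
  have "Poly_Mapping.keys (frag_map u z) \<subseteq> (\<Union>p\<in>Poly_Mapping.keys z. Poly_Mapping.keys (frag_of (fst p, u (snd p))))"
    unfolding frag_map_def by (rule order_trans[OF keys_frag_extend]) (auto simp: case_prod_beta)
  then show ?thesis using assms by fastforce
qed

lemma frag_map_comp: "frag_map v (frag_map u z) = frag_map (\<lambda>a. v (u a)) z"
  by (induction z rule: frag_induction[OF subset_UNIV]) auto

lemma frag_map_id:
  assumes "\<And>x a. (x, a) \<in> Poly_Mapping.keys z \<Longrightarrow> u a = a"
  shows "frag_map u z = z"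
proof -
  have "frag_map u z = frag_extend frag_of z"
    unfolding frag_map_def using assms by (intro frag_extend_eq) auto
  then show ?thesis by (metis frag_expansion)
qed

lemma (in right_module) tensor_relations_closed:
  assumes "left_module R A" "z \<in> tensor_relations R M A"
  shows "Poly_Mapping.keys z \<subseteq> carrier M \<times> carrier A"
proof -
  interpret A: left_module R A by fact
  have *: "Poly_Mapping.keys (p - q) \<subseteq> S" if "Poly_Mapping.keys p \<subseteq> S" "Poly_Mapping.keys q \<subseteq> S" for p q :: "_ \<Rightarrow>\<^sub>0 int" and S
    using that keys_diff[of p q] by blast
  show ?thesis
    using assms(2) unfolding tensor_relations_def Un_iff mem_Collect_eq
    by (elim disjE exE conjE; hypsubst; intro *; simp)
qed

lemma (in right_module) tensor_rel_subgroup: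
  assumes "left_module R A"
  shows "subgroup (tensor_rel R M A) (tensor_free M A)"
  unfolding tensor_rel_def using tensor_relations_closed[OF assms]
  by (intro group.generate_is_subgroup) auto

lemma (in right_module) tensor_rel_closed:
  assumes "left_module R A"
  shows "0 \<in> tensor_rel R M A"
    and "z \<in> tensor_rel R M A \<Longrightarrow> Poly_Mapping.keys z \<subseteq> carrier M \<times> carrier A"
    and "z \<in> tensor_rel R M A \<Longrightarrow> w \<in> tensor_rel R M A \<Longrightarrow> z + w \<in> tensor_rel R M A"
    and "z \<in> tensor_rel R M A \<Longrightarrow> - z \<in> tensor_rel R M A"
    and "z \<in> tensor_rel R M A \<Longrightarrow> w \<in> tensor_rel R M A \<Longrightarrow> z - w \<in> tensor_rel R M A"
    and "z \<in> tensor_relations R M A \<Longrightarrow> z \<in> tensor_rel R M A"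
proof -
  interpret S: subgroup "tensor_rel R M A" "tensor_free M A"
    by (rule tensor_rel_subgroup[OF assms])
  show 1: "0 \<in> tensor_rel R M A" using S.one_closed by simp
  show 2: "Poly_Mapping.keys z \<subseteq> carrier M \<times> carrier A" if "z \<in> tensor_rel R M A" for z
    using S.mem_carrier[OF that] by simp
  show 3: "z + w \<in> tensor_rel R M A" if "z \<in> tensor_rel R M A" "w \<in> tensor_rel R M A" for z w
    using S.m_closed[OF that] by simp
  show 4: "- z \<in> tensor_rel R M A" if "z \<in> tensor_rel R M A" for z
    using S.m_inv_closed[OF that] 2[OF that] by simp
  show "z - w \<in> tensor_rel R M A" if "z \<in> tensor_rel R M A" "w \<in> tensor_rel R M A"
    using 3[OF that(1) 4[OF that(2)]] by simp
  show "z \<in> tensor_rel R M A" if "z \<in> tensor_relations R M A"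
    using that unfolding tensor_rel_def by (rule generate.incl)
qed

lemma (in right_module) tensor_rel_induct:
  assumes A: "left_module R A" and z: "z \<in> tensor_rel R M A"
    and "P 0" and "\<And>r. r \<in> tensor_relations R M A \<Longrightarrow> P r"
    and "\<And>r. r \<in> tensor_relations R M A \<Longrightarrow> P (- r)"
    and "\<And>r s. P r \<Longrightarrow> P s \<Longrightarrow> P (r + s)"
  shows "P z"
  using z unfolding tensor_rel_def
proof (induction rule: generate.induct)
  case (inv h)
  then show ?case using tensor_relations_closed[OF A, of h] assms(5)[of h] by simp
qed (use assms in auto)

lemma (in right_module) frag_map_tensor_rel:
  assumes A: "left_module R A" and B: "left_module R B" and u: "u \<in> mod_hom R A B"
    and z: "z \<in> tensor_rel R M A"
  shows "frag_map u z \<in> tensor_rel R M B"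
proof -
  have rel: "frag_map u r \<in> tensor_rel R M B" if "r \<in> tensor_relations R M A" for r
  proof -
    have "frag_map u r \<in> tensor_relations R M B"
      using that unfolding tensor_relations_def
      by (auto simp: mod_homD[OF u]) (blast intro: mod_homD(1)[OF u])+
    then show ?thesis by (rule tensor_rel_closed(6)[OF B])
  qed
  show ?thesis
    by (rule tensor_rel_induct[OF A z]) (auto simp: rel tensor_rel_closed[OF B])
qed

lemma (in right_module) tensor_coset_eq_iff:
  assumes "left_module R A" "Poly_Mapping.keys z \<subseteq> carrier M \<times> carrier A" "Poly_Mapping.keys w \<subseteq> carrier M \<times> carrier A"
  shows "tensor_rel R M A #>\<^bsub>tensor_free M A\<^esub> z = tensor_rel R M A #>\<^bsub>tensor_free M A\<^esub> w
    \<longleftrightarrow> z - w \<in> tensor_rel R M A"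
proof
  note cl = tensor_rel_closed[OF assms(1)]
  assume "tensor_rel R M A #>\<^bsub>tensor_free M A\<^esub> z = tensor_rel R M A #>\<^bsub>tensor_free M A\<^esub> w"
  moreover have "z \<in> tensor_rel R M A #>\<^bsub>tensor_free M A\<^esub> z"
    using cl(1) by (force simp: r_coset_def)
  ultimately show "z - w \<in> tensor_rel R M A" by (auto simp: r_coset_def)
next
  note cl = tensor_rel_closed[OF assms(1)]
  assume d: "z - w \<in> tensor_rel R M A"
  have "h + z \<in> tensor_rel R M A #>\<^bsub>tensor_free M A\<^esub> w" if "h \<in> tensor_rel R M A" for h
    using cl(3)[OF that d] by (auto simp: r_coset_def intro!: bexI[of _ "h + (z - w)"])
  moreover have "h + w \<in> tensor_rel R M A #>\<^bsub>tensor_free M A\<^esub> z" if "h \<in> tensor_rel R M A" for h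
    using cl(5)[OF that d] by (auto simp: r_coset_def intro!: bexI[of _ "h - (z - w)"])
  ultimately show "tensor_rel R M A #>\<^bsub>tensor_free M A\<^esub> z = tensor_rel R M A #>\<^bsub>tensor_free M A\<^esub> w"
    by (auto simp: r_coset_def)
qed

lemma (in right_module) tensor_map_coset:
  assumes A: "left_module R A" and B: "left_module R B" and u: "u \<in> mod_hom R A B"
    and z: "Poly_Mapping.keys z \<subseteq> carrier M \<times> carrier A"
  shows "tensor_map R M B u (tensor_rel R M A #>\<^bsub>tensor_free M A\<^esub> z) =
    tensor_rel R M B #>\<^bsub>tensor_free M B\<^esub> frag_map u z"
proof (intro equalityI subsetI)
  fix y assume "y \<in> tensor_map R M B u (tensor_rel R M A #>\<^bsub>tensor_free M A\<^esub> z)"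
  then obtain h k where h: "h \<in> tensor_rel R M B" and k: "k \<in> tensor_rel R M A"
    and y: "y = h + frag_map u (k + z)"
    by (auto simp: tensor_map_def set_mult_def r_coset_def)
  have "h + frag_map u k \<in> tensor_rel R M B"
    by (rule tensor_rel_closed(3)[OF B h frag_map_tensor_rel[OF A B u k]])
  then show "y \<in> tensor_rel R M B #>\<^bsub>tensor_free M B\<^esub> frag_map u z"
    by (auto simp: r_coset_def y add.assoc intro!: bexI[of _ "h + frag_map u k"])
next
  fix y assume "y \<in> tensor_rel R M B #>\<^bsub>tensor_free M B\<^esub> frag_map u z"
  then obtain h where "h \<in> tensor_rel R M B" "y = h + frag_map u (0 + z)"
    by (auto simp: r_coset_def)
  then show "y \<in> tensor_map R M B u (tensor_rel R M A #>\<^bsub>tensor_free M A\<^esub> z)"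
    using tensor_rel_closed(1)[OF A]
    unfolding tensor_map_def set_mult_def r_coset_def mult_free_Abelian_group
    by blast
qed

lemma (in right_module) tensor_productE:
  assumes "X \<in> carrier (tensor_product R M A)"
  obtains z where "Poly_Mapping.keys z \<subseteq> carrier M \<times> carrier A"
    "X = tensor_rel R M A #>\<^bsub>tensor_free M A\<^esub> z"
  using assms by (auto simp: tensor_product_def FactGroup_def RCOSETS_def)

lemma (in right_module) tensor_rel_normal:
  assumes "left_module R A"
  shows "tensor_rel R M A \<lhd> tensor_free M A"
  by (rule comm_group.normal_iff_subgroup[THEN iffD2, OF abelian_free_Abelian_group
        tensor_rel_subgroup[OF assms]])

lemma (in right_module) tensor_map_hom:
  assumes A: "left_module R A" and B: "left_module R B" and u: "u \<in> mod_hom R A B"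
  shows "tensor_map R M B u \<in> hom (tensor_product R M A) (tensor_product R M B)"
proof (rule homI)
  fix X assume "X \<in> carrier (tensor_product R M A)"
  then obtain z where z: "Poly_Mapping.keys z \<subseteq> carrier M \<times> carrier A"
    "X = tensor_rel R M A #>\<^bsub>tensor_free M A\<^esub> z" by (rule tensor_productE)
  have "Poly_Mapping.keys (frag_map u z) \<subseteq> carrier M \<times> carrier B"
    by (rule frag_map_closed[OF z(1) mod_homD(1)[OF u]])
  then show "tensor_map R M B u X \<in> carrier (tensor_product R M B)"
    unfolding z(2) tensor_map_coset[OF A B u z(1)]
    by (auto simp: tensor_product_def FactGroup_def RCOSETS_def)
next
  fix X Y assume X: "X \<in> carrier (tensor_product R M A)" and Y: "Y \<in> carrier (tensor_product R M A)"
  obtain z where z: "Poly_Mapping.keys z \<subseteq> carrier M \<times> carrier A"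
    "X = tensor_rel R M A #>\<^bsub>tensor_free M A\<^esub> z" using X by (rule tensor_productE)
  obtain w where w: "Poly_Mapping.keys w \<subseteq> carrier M \<times> carrier A"
    "Y = tensor_rel R M A #>\<^bsub>tensor_free M A\<^esub> w" using Y by (rule tensor_productE)
  note cl = frag_map_closed[OF _ mod_homD(1)[OF u], of _ "carrier M"]
  have zw: "Poly_Mapping.keys (z + w) \<subseteq> carrier M \<times> carrier A"
    using keys_add[of z w] z(1) w(1) by blast
  show "tensor_map R M B u (X \<otimes>\<^bsub>tensor_product R M A\<^esub> Y) =
    tensor_map R M B u X \<otimes>\<^bsub>tensor_product R M B\<^esub> tensor_map R M B u Y"
    using normal.rcos_sum[OF tensor_rel_normal[OF A], of z w] z(1) w(1) zw
      normal.rcos_sum[OF tensor_rel_normal[OF B], of "frag_map u z" "frag_map u w"]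
      cl[OF z(1)] cl[OF w(1)]
    by (simp add: tensor_product_def z(2) w(2) tensor_map_coset[OF A B u])
qed

lemma (in right_module) tensor_map_inj_iff:
  assumes A: "left_module R A" and B: "left_module R B" and u: "u \<in> mod_hom R A B"
  shows "inj_on (tensor_map R M B u) (carrier (tensor_product R M A)) \<longleftrightarrow>
    (\<forall>z. Poly_Mapping.keys z \<subseteq> carrier M \<times> carrier A \<and> frag_map u z \<in> tensor_rel R M B
       \<longrightarrow> z \<in> tensor_rel R M A)"
proof safe
  note cl = frag_map_closed[OF _ mod_homD(1)[OF u], of _ "carrier M"]
  let ?c = "\<lambda>z. tensor_rel R M A #>\<^bsub>tensor_free M A\<^esub> z"
  { fix z assume inj: "inj_on (tensor_map R M B u) (carrier (tensor_product R M A))"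
      and z: "Poly_Mapping.keys z \<subseteq> carrier M \<times> carrier A" and k: "frag_map u z \<in> tensor_rel R M B"
    have "?c z \<in> carrier (tensor_product R M A)" "?c 0 \<in> carrier (tensor_product R M A)"
      using z by (auto simp: tensor_product_def FactGroup_def RCOSETS_def)
    moreover have "tensor_map R M B u (?c z) = tensor_map R M B u (?c 0)"
      using z k cl[OF z] by (simp add: tensor_map_coset[OF A B u] tensor_coset_eq_iff[OF B])
    ultimately have "?c z = ?c 0" using inj by (auto dest: inj_onD)
    then show "z \<in> tensor_rel R M A" using z by (simp add: tensor_coset_eq_iff[OF A]) }
  { assume ker: "\<forall>z. Poly_Mapping.keys z \<subseteq> carrier M \<times> carrier A \<and> frag_map u z \<in> tensor_rel R M B
       \<longrightarrow> z \<in> tensor_rel R M A"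
    show "inj_on (tensor_map R M B u) (carrier (tensor_product R M A))"
    proof (rule inj_onI)
      fix X Y assume XY: "X \<in> carrier (tensor_product R M A)" "Y \<in> carrier (tensor_product R M A)"
        and eq: "tensor_map R M B u X = tensor_map R M B u Y"
      obtain z where z: "Poly_Mapping.keys z \<subseteq> carrier M \<times> carrier A" "X = ?c z"
        using XY(1) by (rule tensor_productE)
      obtain w where w: "Poly_Mapping.keys w \<subseteq> carrier M \<times> carrier A" "Y = ?c w"
        using XY(2) by (rule tensor_productE)
      have "frag_map u (z - w) \<in> tensor_rel R M B"
        using eq z w cl[OF z(1)] cl[OF w(1)]
        by (simp add: tensor_map_coset[OF A B u] tensor_coset_eq_iff[OF B])
      moreover have "Poly_Mapping.keys (z - w) \<subseteq> carrier M \<times> carrier A"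
        using z(1) w(1) keys_diff[of z w] by blast
      ultimately show "X = Y" using ker z w by (simp add: tensor_coset_eq_iff[OF A])
    qed }
qed

subsection \<open>Flatness\<close>

context left_module
begin

lemma smult_l_null [simp]: "x \<in> carrier M \<Longrightarrow> \<zero> \<odot>\<^bsub>M\<^esub> x = \<zero>\<^bsub>M\<^esub>"
  using smult_l_distr[of \<zero> \<zero> x] by (metis M.add.r_cancel_one' R.l_zero R.zero_closed smult_closed)

lemma smult_r_null [simp]: "a \<in> carrier R \<Longrightarrow> a \<odot>\<^bsub>M\<^esub> \<zero>\<^bsub>M\<^esub> = \<zero>\<^bsub>M\<^esub>"
  using smult_r_distr[of a "\<zero>\<^bsub>M\<^esub>" "\<zero>\<^bsub>M\<^esub>"]
  by (metis M.add.r_cancel_one' M.l_zero M.zero_closed smult_closed)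

lemma smult_l_minus:
  "a \<in> carrier R \<Longrightarrow> x \<in> carrier M \<Longrightarrow> (\<ominus> a) \<odot>\<^bsub>M\<^esub> x = \<ominus>\<^bsub>M\<^esub> (a \<odot>\<^bsub>M\<^esub> x)"
  using smult_l_distr[of "\<ominus> a" a x]
  by (metis M.minus_equality R.a_inv_closed R.l_neg smult_closed smult_l_null)

lemma smult_finsum:
  assumes "finite S" "a \<in> carrier R" "f \<in> S \<rightarrow> carrier M"
  shows "a \<odot>\<^bsub>M\<^esub> finsum M f S = (\<Oplus>\<^bsub>M\<^esub>s\<in>S. a \<odot>\<^bsub>M\<^esub> f s)"
  using assms by (induction S) (simp_all add: Pi_def smult_r_distr)

lemma submoduleI:
  assumes "H \<subseteq> carrier M" "\<zero>\<^bsub>M\<^esub> \<in> H"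
    and "\<And>a. a \<in> H \<Longrightarrow> \<ominus>\<^bsub>M\<^esub> a \<in> H"
    and "\<And>a b. a \<in> H \<Longrightarrow> b \<in> H \<Longrightarrow> a \<oplus>\<^bsub>M\<^esub> b \<in> H"
    and "\<And>a x. a \<in> carrier R \<Longrightarrow> x \<in> H \<Longrightarrow> a \<odot>\<^bsub>M\<^esub> x \<in> H"
  shows "submodule H R M"
  using assms by (intro submodule.intro subgroup.intro submodule_axioms.intro) (auto simp: a_inv_def)

lemma submodule_left_module:
  assumes "submodule H R M"
  shows "left_module R (M\<lparr>carrier := H\<rparr>)"
proof -
  interpret H: submodule H R M by fact
  have "comm_group ((add_monoid M)\<lparr>carrier := H\<rparr>)"
    by (rule group.group_comm_groupI) 
      (use H.subgroup_is_group[OF M.a_group] H.subset M.a_comm in \<open>auto\<close>)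
  then have "abelian_group (M\<lparr>carrier := H\<rparr>)"
    by (intro abelian_group.intro abelian_monoid.intro abelian_group_axioms.intro)
      (simp_all add: comm_group_def)
  then show ?thesis
    using H.subset
    by (intro left_module.intro left_module_axioms.intro)
      (auto simp: R.ring_axioms smult_l_distr smult_r_distr smult_assoc_left subsetD)
qed

definition span_set :: "'m set \<Rightarrow> 'm set"
  where "span_set S = {\<Oplus>\<^bsub>M\<^esub>s\<in>S. c s \<odot>\<^bsub>M\<^esub> s |c. c \<in> S \<rightarrow> carrier R}"

lemma submodule_span_set:
  assumes S: "finite S" "S \<subseteq> carrier M"
  shows "submodule (span_set S) R M" and "S \<subseteq> span_set S"
proof -
  have cl: "(\<lambda>s. c s \<odot>\<^bsub>M\<^esub> s) \<in> S \<rightarrow> carrier M" if "c \<in> S \<rightarrow> carrier R" for c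
    using that S by (auto simp: Pi_iff)
  have mem: "x \<in> span_set S" if "c \<in> S \<rightarrow> carrier R" "x = (\<Oplus>\<^bsub>M\<^esub>s\<in>S. c s \<odot>\<^bsub>M\<^esub> s)" for c x
    using that unfolding span_set_def by auto
  have smult: "a \<odot>\<^bsub>M\<^esub> x \<in> span_set S" if ax: "a \<in> carrier R" "x \<in> span_set S" for a x
  proof -
    obtain c where c: "c \<in> S \<rightarrow> carrier R" "x = (\<Oplus>\<^bsub>M\<^esub>s\<in>S. c s \<odot>\<^bsub>M\<^esub> s)"
      using ax(2) unfolding span_set_def by auto
    show ?thesis
    proof (rule mem[of "\<lambda>s. a \<otimes> c s"])
      show "a \<odot>\<^bsub>M\<^esub> x = (\<Oplus>\<^bsub>M\<^esub>s\<in>S. (a \<otimes> c s) \<odot>\<^bsub>M\<^esub> s)"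
        unfolding c(2) smult_finsum[OF S(1) ax(1) cl[OF c(1)]]
        using c(1) S ax(1) by (intro M.finsum_cong') (auto simp: smult_assoc_left Pi_iff subset_iff)
    qed (use c ax in auto)
  qed
  have sub: "span_set S \<subseteq> carrier M"
    unfolding span_set_def using cl by (auto intro: M.finsum_closed)
  show "submodule (span_set S) R M"
  proof (rule submoduleI[OF sub])
    show "\<zero>\<^bsub>M\<^esub> \<in> span_set S"
      using S by (intro mem[of "\<lambda>_. \<zero>"]) (auto intro!: M.add.finprod_one_eqI[symmetric])
    show "\<ominus>\<^bsub>M\<^esub> a \<in> span_set S" if "a \<in> span_set S" for a
      using smult[OF _ that, of "\<ominus> \<one>"] sub that by (auto simp: smult_l_minus)
    show "a \<oplus>\<^bsub>M\<^esub> b \<in> span_set S" if ab: "a \<in> span_set S" "b \<in> span_set S" for a b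
    proof -
      obtain c where c: "c \<in> S \<rightarrow> carrier R" "a = (\<Oplus>\<^bsub>M\<^esub>s\<in>S. c s \<odot>\<^bsub>M\<^esub> s)"
        using ab(1) unfolding span_set_def by auto
      obtain d where d: "d \<in> S \<rightarrow> carrier R" "b = (\<Oplus>\<^bsub>M\<^esub>s\<in>S. d s \<odot>\<^bsub>M\<^esub> s)"
        using ab(2) unfolding span_set_def by auto
      show ?thesis
      proof (rule mem[of "\<lambda>s. c s \<oplus> d s"])
        show "a \<oplus>\<^bsub>M\<^esub> b = (\<Oplus>\<^bsub>M\<^esub>s\<in>S. (c s \<oplus> d s) \<odot>\<^bsub>M\<^esub> s)"
          unfolding c(2) d(2) M.finsum_addf[OF cl[OF c(1)] cl[OF d(1)], symmetric]
          using c(1) d(1) S by (intro M.finsum_cong') (auto simp: smult_l_distr Pi_iff subset_iff)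
      qed (use c d in auto)
    qed
  qed (rule smult)
  show "S \<subseteq> span_set S"
  proof
    fix t assume t: "t \<in> S"
    have "t = (\<Oplus>\<^bsub>M\<^esub>s\<in>S. if t = s then t else \<zero>\<^bsub>M\<^esub>)"
      using M.finsum_singleton[OF t S(1), of "\<lambda>_. t"] t S(2) by auto
    also have "\<dots> = (\<Oplus>\<^bsub>M\<^esub>s\<in>S. (if t = s then \<one> else \<zero>) \<odot>\<^bsub>M\<^esub> s)"
      using S(2) t by (intro M.finsum_cong') auto
    finally show "t \<in> span_set S" by (intro mem[of "\<lambda>s. if t = s then \<one> else \<zero>"]) auto
  qed
qed

lemma span_set_embedding:
  assumes S: "finite S" "S \<subseteq> carrier M"
  shows "\<exists>\<phi> :: 'm \<Rightarrow> (nat \<Rightarrow> 'a) set. inj_on \<phi> (span_set S)"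
proof -
  obtain i :: "'m \<Rightarrow> nat" where i: "inj_on i S"
    using finite_imp_inj_to_nat_seg[OF S(1)] by blast
  let ?\<phi> = "\<lambda>x. {d. (\<forall>n. d n \<in> carrier R) \<and> x = (\<Oplus>\<^bsub>M\<^esub>s\<in>S. d (i s) \<odot>\<^bsub>M\<^esub> s)}"
  have "\<exists>d. d \<in> ?\<phi> x" if x: "x \<in> span_set S" for x
  proof -
    obtain c where c: "c \<in> S \<rightarrow> carrier R" "x = (\<Oplus>\<^bsub>M\<^esub>s\<in>S. c s \<odot>\<^bsub>M\<^esub> s)"
      using x unfolding span_set_def by auto
    let ?d = "\<lambda>n. if n \<in> i ` S then c (the_inv_into S i n) else \<zero>"
    have cl: "c s \<odot>\<^bsub>M\<^esub> s \<in> carrier M" if "s \<in> S" for s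
      using c(1) S(2) that by blast
    have "?d n \<in> carrier R" for n
      using c(1) i by (auto simp: the_inv_into_f_f)
    moreover have "x = (\<Oplus>\<^bsub>M\<^esub>s\<in>S. ?d (i s) \<odot>\<^bsub>M\<^esub> s)"
      unfolding c(2) using cl by (intro M.finsum_cong') (auto simp: the_inv_into_f_f[OF i])
    ultimately show ?thesis by (intro exI[of _ ?d] CollectI conjI allI)
  qed
  note ex = this
  have "inj_on ?\<phi> (span_set S)"
  proof (rule inj_onI)
    fix x y assume xy: "x \<in> span_set S" "?\<phi> x = ?\<phi> y"
    obtain d where d: "d \<in> ?\<phi> x" using ex[OF xy(1)] by (rule exE)
    have "d \<in> ?\<phi> y" using d unfolding xy(2) .
    with d show "x = y" unfolding mem_Collect_eq by (elim conjE) (rule trans[OF _ sym])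
  qed
  then show ?thesis by (rule exI[where x = "?\<phi>"])
qed

lemma transport_left_module:
  fixes \<phi> :: "'m \<Rightarrow> 'n"
  assumes \<phi>: "inj_on \<phi> (carrier M)"
  shows "\<exists>N :: ('a, 'n) module. left_module R N \<and> carrier N = \<phi> ` carrier M \<and> \<phi> \<in> mod_hom R M N"
proof -
  let ?i = "the_inv_into (carrier M) \<phi>"
  note i = the_inv_into_f_f[OF \<phi>]
  define N :: "('a, 'n) module" where "N =
    \<lparr>carrier = \<phi> ` carrier M, mult = (\<lambda>_ _. undefined), one = undefined, zero = \<phi> \<zero>\<^bsub>M\<^esub>,
     add = (\<lambda>x y. \<phi> (?i x \<oplus>\<^bsub>M\<^esub> ?i y)), smult = (\<lambda>a x. \<phi> (a \<odot>\<^bsub>M\<^esub> ?i x))\<rparr>"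
  have "abelian_group N"
  proof (rule abelian_groupI)
    fix x assume "x \<in> carrier N"
    then obtain m where m: "m \<in> carrier M" "x = \<phi> m" by (auto simp: N_def)
    then show "\<exists>y\<in>carrier N. y \<oplus>\<^bsub>N\<^esub> x = \<zero>\<^bsub>N\<^esub>"
      by (intro bexI[of _ "\<phi> (\<ominus>\<^bsub>M\<^esub> m)"]) (auto simp: N_def i M.l_neg)
  qed (auto simp: N_def i M.a_ac)
  then have "left_module R N"
    by (intro left_module.intro left_module_axioms.intro)
      (auto simp: R.ring_axioms N_def i smult_l_distr smult_r_distr smult_assoc_left)
  moreover have "\<phi> \<in> mod_hom R M N" by (auto simp: mod_hom_def N_def i)
  ultimately show ?thesis by (intro exI[of _ N]) (simp add: N_def)
qed

end

lemma (in right_module) tensor_rel_finite_support: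
  assumes B: "left_module R B" and z: "z \<in> tensor_rel R M B"
  shows "\<exists>S. finite S \<and> S \<subseteq> carrier B \<and>
    (\<forall>H. submodule H R B \<and> S \<subseteq> H \<longrightarrow> z \<in> tensor_rel R M (B\<lparr>carrier := H\<rparr>))"
proof -
  interpret B: left_module R B by fact
  note lm = B.submodule_left_module
  have rel: "\<exists>S. finite S \<and> S \<subseteq> carrier B \<and>
      (\<forall>H. submodule H R B \<and> S \<subseteq> H \<longrightarrow> r \<in> tensor_rel R M (B\<lparr>carrier := H\<rparr>))"
    if "r \<in> tensor_relations R M B" for r
  proof -
    have "\<exists>S. finite S \<and> S \<subseteq> carrier B \<and>
      (\<forall>H. S \<subseteq> H \<longrightarrow> r \<in> tensor_relations R M (B\<lparr>carrier := H\<rparr>))"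
      using that unfolding tensor_relations_def Un_iff mem_Collect_eq
    proof (elim disjE exE conjE, goal_cases)
      case (1 x y a)
      then show ?case by (intro exI[of _ "{a}"]) auto
    next
      case (2 x a b)
      then show ?case by (intro exI[of _ "{a, b}"]) auto
    next
      case (3 s x a)
      then show ?case by (intro exI[of _ "{a}"]) auto
    qed
    then show ?thesis using tensor_rel_closed(6)[OF lm] by meson
  qed
  show ?thesis
  proof (rule tensor_rel_induct[OF B z], goal_cases)
    case 1
    show ?case using tensor_rel_closed(1)[OF lm] by (intro exI[of _ "{}"]) auto
  next
    case (2 r)
    then show ?case by (rule rel)
  next
    case (3 r)
    then show ?case using rel[OF 3] tensor_rel_closed(4)[OF lm] by meson
  next
    case (4 r s)
    then obtain S T where
      "finite S" "S \<subseteq> carrier B" "finite T" "T \<subseteq> carrier B"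
      "\<And>H. submodule H R B \<Longrightarrow> S \<subseteq> H \<Longrightarrow> r \<in> tensor_rel R M (B\<lparr>carrier := H\<rparr>)"
      "\<And>H. submodule H R B \<Longrightarrow> T \<subseteq> H \<Longrightarrow> s \<in> tensor_rel R M (B\<lparr>carrier := H\<rparr>)"
      by auto
    then show ?case using tensor_rel_closed(3)[OF lm] by (intro exI[of _ "S \<union> T"]) auto
  qed
qed

theorem flat_module_tensor_inj:
  fixes F :: "('r, 'f, 'y) module_scheme" and A :: "('r, 'a, 'z) module_scheme"
    and B :: "('r, 'b, 'w) module_scheme"
  assumes F: "flat_module R F" and A: "left_module R A" and B: "left_module R B"
    and u: "u \<in> mod_hom R A B" and inj: "inj_on u (carrier A)"
  shows "inj_on (tensor_map R F B u) (carrier (tensor_product R F A))"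
proof -
  interpret F: right_module R F using F by (simp add: flat_module_def)
  interpret A: left_module R A by fact
  interpret B: left_module R B by fact
  note uD = mod_homD[OF u]
  have "z \<in> tensor_rel R F A"
    if z: "Poly_Mapping.keys z \<subseteq> carrier F \<times> carrier A"
      and k: "frag_map u z \<in> tensor_rel R F B" for z
  proof -
    obtain S where S: "finite S" "S \<subseteq> carrier B"
      "\<And>H. submodule H R B \<Longrightarrow> S \<subseteq> H \<Longrightarrow> frag_map u z \<in> tensor_rel R F (B\<lparr>carrier := H\<rparr>)"
      using F.tensor_rel_finite_support[OF B k] by blast
    define T where "T = S \<union> u ` snd ` Poly_Mapping.keys z"
    have T: "finite T" "T \<subseteq> carrier B"
      using S z uD(1) unfolding T_def by (auto dest!: subsetD)
    define H where "H = B.span_set T"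
    have H: "submodule H R B" "T \<subseteq> H"
      unfolding H_def by (rule B.submodule_span_set[OF T])+
    interpret H: submodule H R B by (rule H(1))
    define B0 where "B0 = B\<lparr>carrier := H\<rparr>"
    have B0: "left_module R B0" unfolding B0_def by (rule B.submodule_left_module[OF H(1)])
    interpret B0: left_module R B0 by (rule B0)
    have B0_simps: "carrier B0 = H" "add B0 = add B" "smult B0 = smult B" "\<zero>\<^bsub>B0\<^esub> = \<zero>\<^bsub>B\<^esub>"
      by (simp_all add: B0_def)
    obtain \<phi> :: "'b \<Rightarrow> (nat \<Rightarrow> 'r) set" where \<phi>: "inj_on \<phi> H"
      using B.span_set_embedding[OF T] unfolding H_def by blast
    obtain B1 :: "('r, (nat \<Rightarrow> 'r) set) module" where
      B1: "left_module R B1" and B1c: "carrier B1 = \<phi> ` H" and \<phi>h: "\<phi> \<in> mod_hom R B0 B1"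
      using B0.transport_left_module[of \<phi>] \<phi> unfolding B0_simps by blast
    interpret B1: left_module R B1 by (rule B1)
    note \<phi>D = mod_homD[OF \<phi>h, unfolded B0_simps]
    define H1 where "H1 = {\<phi> (u a) |a. a \<in> carrier A \<and> u a \<in> H}"
    have u0: "u \<zero>\<^bsub>A\<^esub> = \<zero>\<^bsub>B\<^esub>"
      using uD(2)[of "\<zero>\<^bsub>A\<^esub>" "\<zero>\<^bsub>A\<^esub>"] uD(1)[of "\<zero>\<^bsub>A\<^esub>"] by simp
    have H1: "submodule H1 R B1"
    proof -
      have zero: "\<zero>\<^bsub>B1\<^esub> = \<phi> (u \<zero>\<^bsub>A\<^esub>)" "u \<zero>\<^bsub>A\<^esub> \<in> H"
        using \<phi>D(2)[of "\<zero>\<^bsub>B\<^esub>" "\<zero>\<^bsub>B\<^esub>"] \<phi>D(1)[of "\<zero>\<^bsub>B\<^esub>"] H.one_closed by (simp_all add: u0)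
      have sm: "a \<odot>\<^bsub>B1\<^esub> x \<in> H1" if ax: "a \<in> carrier R" "x \<in> H1" for a x
      proof -
        obtain b where b: "b \<in> carrier A" "u b \<in> H" "x = \<phi> (u b)" using ax(2) H1_def by auto
        have "u (a \<odot>\<^bsub>A\<^esub> b) \<in> H" "\<phi> (u (a \<odot>\<^bsub>A\<^esub> b)) = a \<odot>\<^bsub>B1\<^esub> x"
          using b ax(1) \<phi>D(3)[of a "u b"] by (simp_all add: uD)
        then show ?thesis unfolding H1_def using b(1) ax(1)
          by (auto intro!: exI[of _ "a \<odot>\<^bsub>A\<^esub> b"])
      qed
      have sub: "H1 \<subseteq> carrier B1" unfolding H1_def B1c by auto
      show ?thesis
      proof (rule B1.submoduleI[OF sub])
        show "\<zero>\<^bsub>B1\<^esub> \<in> H1" unfolding H1_def using zero by auto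
        show "\<ominus>\<^bsub>B1\<^esub> a \<in> H1" if "a \<in> H1" for a
          using sm[OF _ that, of "\<ominus>\<^bsub>R\<^esub> \<one>\<^bsub>R\<^esub>"] sub that by (auto simp: B1.smult_l_minus)
        show "a \<oplus>\<^bsub>B1\<^esub> b \<in> H1" if ab: "a \<in> H1" "b \<in> H1" for a b
        proof -
          obtain c d where c: "c \<in> carrier A" "u c \<in> H" "a = \<phi> (u c)"
            and d: "d \<in> carrier A" "u d \<in> H" "b = \<phi> (u d)" using ab H1_def by auto
          have "u (c \<oplus>\<^bsub>A\<^esub> d) \<in> H" "\<phi> (u (c \<oplus>\<^bsub>A\<^esub> d)) = a \<oplus>\<^bsub>B1\<^esub> b"
            using c d \<phi>D(2)[of "u c" "u d"] H.m_closed[of "u c" "u d"] by (simp_all add: uD)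
          then show ?thesis unfolding H1_def using c(1) d(1)
            by (auto intro!: exI[of _ "c \<oplus>\<^bsub>A\<^esub> d"])
        qed
      qed (rule sm)
    qed
    define A1 where "A1 = B1\<lparr>carrier := H1\<rparr>"
    have A1: "left_module R A1" unfolding A1_def by (rule B1.submodule_left_module[OF H1])
    have A1_simps: "carrier A1 = H1" "add A1 = add B1" "smult A1 = smult B1"
      by (simp_all add: A1_def)
    have sub: "H1 \<subseteq> carrier B1" unfolding H1_def B1c by auto
    have incl: "(\<lambda>x. x) \<in> mod_hom R A1 B1" using sub by (auto simp: mod_hom_def A1_simps)
    define w where "w = frag_map (\<lambda>a. \<phi> (u a)) z"
    have w: "w \<in> tensor_rel R F B1"
      using F.frag_map_tensor_rel[OF B0 B1 \<phi>h, of "frag_map u z"] S(3)[OF H(1)] H(2)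
      by (simp add: w_def frag_map_comp B0_def T_def)
    have snd_H: "u a \<in> H" "a \<in> carrier A" if "(x, a) \<in> Poly_Mapping.keys z" for x a
      using that z H(2) by (force simp: T_def)+
    have wk: "Poly_Mapping.keys w \<subseteq> carrier F \<times> carrier A1"
      unfolding w_def
    proof (rule frag_map_closed[of _ _ "snd ` Poly_Mapping.keys z"])
      show "Poly_Mapping.keys z \<subseteq> carrier F \<times> snd ` Poly_Mapping.keys z" using z by force
      show "\<phi> (u a) \<in> carrier A1" if "a \<in> snd ` Poly_Mapping.keys z" for a
        using that snd_H by (force simp: A1_simps H1_def)
    qed
    have "inj_on (tensor_map R F B1 (\<lambda>x. x)) (carrier (tensor_product R F A1))"
      using F A1 B1 incl unfolding flat_module_def by auto
    then have wA1: "w \<in> tensor_rel R F A1"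
      using wk w unfolding F.tensor_map_inj_iff[OF A1 B1 incl] by (simp add: frag_map_id)
    define \<psi> where "\<psi> x = the_inv_into (carrier A) u (the_inv_into H \<phi> x)" for x
    have \<psi>: "\<psi> (\<phi> (u a)) = a" if "a \<in> carrier A" "u a \<in> H" for a
      using that by (simp add: \<psi>_def the_inv_into_f_f[OF \<phi>] the_inv_into_f_f[OF inj])
    have \<psi>h: "\<psi> \<in> mod_hom R A1 A"
    proof -
      have "\<psi> (\<phi> (u c) \<oplus>\<^bsub>B1\<^esub> \<phi> (u d)) = c \<oplus>\<^bsub>A\<^esub> d"
        if "c \<in> carrier A" "u c \<in> H" "d \<in> carrier A" "u d \<in> H" for c d
        using that \<phi>D(2)[of "u c" "u d"] uD(2)[of c d] H.m_closed[of "u c" "u d"]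
          \<psi>[of "c \<oplus>\<^bsub>A\<^esub> d"] by simp
      moreover have "\<psi> (a \<odot>\<^bsub>B1\<^esub> \<phi> (u c)) = a \<odot>\<^bsub>A\<^esub> c"
        if "a \<in> carrier R" "c \<in> carrier A" "u c \<in> H" for a c
        using that \<phi>D(3)[of a "u c"] uD(3)[of a c] H.smult_closed[of a "u c"]
          \<psi>[of "a \<odot>\<^bsub>A\<^esub> c"] by simp
      ultimately show ?thesis by (auto simp: mod_hom_def A1_simps H1_def \<psi>)
    qed
    have "frag_map \<psi> w = z"
      unfolding w_def frag_map_comp by (rule frag_map_id) (use snd_H in \<open>auto simp: \<psi>\<close>)
    then show ?thesis using F.frag_map_tensor_rel[OF A1 A \<psi>h wA1] by simp
  qed
  then show ?thesis unfolding F.tensor_map_inj_iff[OF A B u] by blast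
qed

subsection \<open>Projectivity\<close>

definition free_right_module :: "('r, 'x) ring_scheme \<Rightarrow> 's set \<Rightarrow> ('r, 's \<Rightarrow> 'r) module"
  where "free_right_module R S =
    \<lparr>carrier = {c. (\<forall>s. c s \<in> carrier R) \<and> finite {s. c s \<noteq> \<zero>\<^bsub>R\<^esub>} \<and> {s. c s \<noteq> \<zero>\<^bsub>R\<^esub>} \<subseteq> S},
     mult = (\<lambda>_ _. undefined), one = undefined, zero = (\<lambda>_. \<zero>\<^bsub>R\<^esub>),
     add = (\<lambda>c d s. c s \<oplus>\<^bsub>R\<^esub> d s), smult = (\<lambda>a c s. c s \<otimes>\<^bsub>R\<^esub> a)\<rparr>"

lemma (in ring) free_right_module: "right_module R (free_right_module R S)"
proof -
  let ?F = "free_right_module R S"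
  have fin: "finite {s. h s \<noteq> \<zero>} \<and> {s. h s \<noteq> \<zero>} \<subseteq> S"
    if "c \<in> carrier ?F" "d \<in> carrier ?F" "\<And>s. c s = \<zero> \<Longrightarrow> d s = \<zero> \<Longrightarrow> h s = \<zero>" for c d h
  proof -
    have "{s. h s \<noteq> \<zero>} \<subseteq> {s. c s \<noteq> \<zero>} \<union> {s. d s \<noteq> \<zero>}" using that(3) by auto
    then show ?thesis using that(1,2) unfolding free_right_module_def
      by (auto dest: finite_subset)
  qed
  have "abelian_group ?F"
  proof (rule abelian_groupI)
    fix c d assume "c \<in> carrier ?F" "d \<in> carrier ?F"
    then show "c \<oplus>\<^bsub>?F\<^esub> d \<in> carrier ?F"
      using fin[of c d "\<lambda>s. c s \<oplus> d s"] by (auto simp: free_right_module_def)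
  next
    fix c assume c: "c \<in> carrier ?F"
    show "\<exists>d\<in>carrier ?F. d \<oplus>\<^bsub>?F\<^esub> c = \<zero>\<^bsub>?F\<^esub>"
      using c fin[OF c c, of "\<lambda>s. \<ominus> c s"]
      by (intro bexI[of _ "\<lambda>s. \<ominus> c s"]) (auto simp: free_right_module_def l_neg)
  qed (auto simp: free_right_module_def a_ac)
  moreover have "a \<odot>\<^bsub>?F\<^esub> c \<in> carrier ?F" if "a \<in> carrier R" "c \<in> carrier ?F" for a c
    using that fin[OF that(2) that(2), of "\<lambda>s. c s \<otimes> a"] by (auto simp: free_right_module_def)
  ultimately show ?thesis
    by (intro right_module.intro right_module_axioms.intro)
      (auto simp: ring_axioms free_right_module_def l_distr r_distr m_assoc)
qed

context right_module
begin

lemma smult_l_null [simp]: "x \<in> carrier M \<Longrightarrow> \<zero> \<odot>\<^bsub>M\<^esub> x = \<zero>\<^bsub>M\<^esub>"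
  using smult_l_distr[of \<zero> \<zero> x] by (metis M.add.r_cancel_one' R.l_zero R.zero_closed smult_closed)

lemma smult_r_null [simp]: "a \<in> carrier R \<Longrightarrow> a \<odot>\<^bsub>M\<^esub> \<zero>\<^bsub>M\<^esub> = \<zero>\<^bsub>M\<^esub>"
  using smult_r_distr[of a "\<zero>\<^bsub>M\<^esub>" "\<zero>\<^bsub>M\<^esub>"]
  by (metis M.add.r_cancel_one' M.l_zero M.zero_closed smult_closed)

lemma smult_finsum:
  assumes "finite S" "a \<in> carrier R" "f \<in> S \<rightarrow> carrier M"
  shows "a \<odot>\<^bsub>M\<^esub> finsum M f S = (\<Oplus>\<^bsub>M\<^esub>s\<in>S. a \<odot>\<^bsub>M\<^esub> f s)"
  using assms by (induction S) (simp_all add: Pi_def smult_r_distr)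

definition lin_ext :: "('s \<Rightarrow> 'm) \<Rightarrow> ('s \<Rightarrow> 'a) \<Rightarrow> 'm"
  where "lin_ext t c = (\<Oplus>\<^bsub>M\<^esub>s\<in>{s. c s \<noteq> \<zero>}. c s \<odot>\<^bsub>M\<^esub> t s)"

lemma lin_ext_eq:
  assumes t: "t \<in> S \<rightarrow> carrier M" and c: "c \<in> carrier (free_right_module R S)"
    and T: "finite T" "{s. c s \<noteq> \<zero>} \<subseteq> T" "T \<subseteq> S"
  shows "lin_ext t c = (\<Oplus>\<^bsub>M\<^esub>s\<in>T. c s \<odot>\<^bsub>M\<^esub> t s)"
  unfolding lin_ext_def using assms
  by (intro M.add.finprod_mono_neutral_cong_left)
    (auto simp: free_right_module_def Pi_iff subset_iff)

lemma lin_ext_hom: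
  assumes t: "t \<in> S \<rightarrow> carrier M"
  shows "lin_ext t \<in> mod_hom R (free_right_module R S) M"
proof -
  let ?F = "free_right_module R S"
  interpret F: right_module R ?F by (rule R.free_right_module)
  have cl: "(\<lambda>s. c s \<odot>\<^bsub>M\<^esub> t s) \<in> T \<rightarrow> carrier M" if "c \<in> carrier ?F" "T \<subseteq> S" for c T
    using that t by (auto simp: free_right_module_def Pi_iff subset_iff)
  have supp: "finite {s. c s \<noteq> \<zero>}" "{s. c s \<noteq> \<zero>} \<subseteq> S" if "c \<in> carrier ?F" for c
    using that by (auto simp: free_right_module_def)
  have cR: "c s \<in> carrier R" if "c \<in> carrier ?F" for c s
    using that by (auto simp: free_right_module_def)
  have "lin_ext t c \<in> carrier M" if c: "c \<in> carrier ?F" for c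
    unfolding lin_ext_def by (rule M.finsum_closed[OF cl[OF c supp(2)[OF c]]])
  moreover have "lin_ext t (c \<oplus>\<^bsub>?F\<^esub> d) = lin_ext t c \<oplus>\<^bsub>M\<^esub> lin_ext t d"
    if c: "c \<in> carrier ?F" and d: "d \<in> carrier ?F" for c d
  proof -
    let ?T = "{s. c s \<noteq> \<zero>} \<union> {s. d s \<noteq> \<zero>}"
    have T: "finite ?T" "?T \<subseteq> S" using supp[OF c] supp[OF d] by auto
    have add: "(c \<oplus>\<^bsub>?F\<^esub> d) s = c s \<oplus> d s" for s by (simp add: free_right_module_def)
    have "lin_ext t (c \<oplus>\<^bsub>?F\<^esub> d) = (\<Oplus>\<^bsub>M\<^esub>s\<in>?T. (c \<oplus>\<^bsub>?F\<^esub> d) s \<odot>\<^bsub>M\<^esub> t s)"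
      by (rule lin_ext_eq[OF t F.M.a_closed[OF c d] T(1) _ T(2)]) (auto simp: add)
    also have "\<dots> = (\<Oplus>\<^bsub>M\<^esub>s\<in>?T. c s \<odot>\<^bsub>M\<^esub> t s \<oplus>\<^bsub>M\<^esub> d s \<odot>\<^bsub>M\<^esub> t s)"
      using cR[OF c] cR[OF d] t T(2) cl[OF c T(2)] cl[OF d T(2)]
      by (intro M.finsum_cong') (auto simp: add smult_l_distr Pi_iff subset_iff)
    also have "\<dots> = (\<Oplus>\<^bsub>M\<^esub>s\<in>?T. c s \<odot>\<^bsub>M\<^esub> t s) \<oplus>\<^bsub>M\<^esub> (\<Oplus>\<^bsub>M\<^esub>s\<in>?T. d s \<odot>\<^bsub>M\<^esub> t s)"
      by (rule M.finsum_addf[OF cl[OF c T(2)] cl[OF d T(2)]])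
    also have "\<dots> = lin_ext t c \<oplus>\<^bsub>M\<^esub> lin_ext t d"
      using lin_ext_eq[OF t c T(1) _ T(2)] lin_ext_eq[OF t d T(1) _ T(2)] by auto
    finally show ?thesis .
  qed
  moreover have "lin_ext t (a \<odot>\<^bsub>?F\<^esub> c) = a \<odot>\<^bsub>M\<^esub> lin_ext t c"
    if a: "a \<in> carrier R" and c: "c \<in> carrier ?F" for a c
  proof -
    let ?T = "{s. c s \<noteq> \<zero>}"
    note T = supp[OF c]
    have sm: "(a \<odot>\<^bsub>?F\<^esub> c) s = c s \<otimes> a" for s by (simp add: free_right_module_def)
    have "lin_ext t (a \<odot>\<^bsub>?F\<^esub> c) = (\<Oplus>\<^bsub>M\<^esub>s\<in>?T. (a \<odot>\<^bsub>?F\<^esub> c) s \<odot>\<^bsub>M\<^esub> t s)"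
      by (rule lin_ext_eq[OF t F.smult_closed[OF a c] T(1) _ T(2)]) (use a in \<open>auto simp: sm\<close>)
    also have "\<dots> = (\<Oplus>\<^bsub>M\<^esub>s\<in>?T. a \<odot>\<^bsub>M\<^esub> (c s \<odot>\<^bsub>M\<^esub> t s))"
      using cR[OF c] t T(2) cl[OF c T(2)] a
      by (intro M.finsum_cong') (auto simp: sm smult_assoc_right Pi_iff subset_iff)
    also have "\<dots> = a \<odot>\<^bsub>M\<^esub> lin_ext t c"
      unfolding lin_ext_def by (rule smult_finsum[OF T(1) a cl[OF c T(2)], symmetric])
    finally show ?thesis .
  qed
  ultimately show ?thesis by (auto simp: mod_hom_def)
qed

lemma lin_ext_basis:
  assumes "t \<in> S \<rightarrow> carrier M" "s \<in> S"
  shows "\<exists>c\<in>carrier (free_right_module R S). lin_ext t c = t s"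
proof -
  define e where "e = (\<lambda>r. if r = s then \<one> else \<zero>)"
  have sub: "{r. e r \<noteq> \<zero>} \<subseteq> {s}" by (auto simp: e_def)
  have c: "e \<in> carrier (free_right_module R S)"
    using sub assms(2) finite_subset[OF sub] by (auto simp: free_right_module_def e_def)
  have "lin_ext t e = (\<Oplus>\<^bsub>M\<^esub>r\<in>{s}. e r \<odot>\<^bsub>M\<^esub> t r)"
    by (rule lin_ext_eq[OF assms(1) c _ sub]) (use assms in auto)
  also have "\<dots> = t s" using funcset_mem[OF assms] by (simp add: e_def)
  finally show ?thesis using c by (rule bexI)
qed

end

lemma mod_hom_finsum:
  assumes M: "right_module R M" and N: "right_module R N" and h: "h \<in> mod_hom R M N"
    and x: "finite S" "x \<in> S \<rightarrow> carrier M"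
  shows "h (finsum M x S) = (\<Oplus>\<^bsub>N\<^esub>s\<in>S. h (x s))"
proof -
  interpret M: right_module R M by fact
  interpret N: right_module R N by fact
  note hD = mod_homD[OF h]
  have "h \<zero>\<^bsub>M\<^esub> = \<zero>\<^bsub>N\<^esub>" using hD(2)[of "\<zero>\<^bsub>M\<^esub>" "\<zero>\<^bsub>M\<^esub>"] hD(1)[of "\<zero>\<^bsub>M\<^esub>"] by simp
  with x show ?thesis by (induction S) (simp_all add: hD Pi_def)
qed

theorem projective_module_lifts:
  fixes P :: "('r, 'p, 'y) module_scheme" and X :: "('r, 'a, 'z) module_scheme"
    and Y :: "('r, 'b, 'w) module_scheme"
  assumes P: "projective_module R P" and X: "right_module R X" and Y: "right_module R Y"
  shows "lifts_along R P X Y"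
  unfolding lifts_along_def
proof safe
  fix f g assume f: "f \<in> mod_epi R X Y" and g: "g \<in> mod_hom R P Y"
  have P': "right_module R P" using P by (simp add: projective_module_def)
  interpret P: right_module R P by (rule P')
  interpret X: right_module R X by fact
  interpret Y: right_module R Y by fact
  let ?F = "free_right_module R (carrier P)"
  interpret F: right_module R ?F by (rule P.R.free_right_module)
  define P0 :: "('r, 'p) module" where "P0 =
    \<lparr>carrier = carrier P, mult = mult P, one = one P, zero = zero P, add = add P, smult = smult P\<rparr>"
  have P0_simps: "carrier P0 = carrier P" "add P0 = add P" "smult P0 = smult P" "zero P0 = zero P"
    by (simp_all add: P0_def)
  have P0: "right_module R P0"
    by (intro right_module.intro right_module_axioms.intro P.R.ring_axioms abelian_groupI)
      (auto simp: P0_simps P.smult_l_distr P.smult_r_distr P.smult_assoc_right P.M.a_ac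
        intro: P.M.add.l_inv_ex)
  have t: "(\<lambda>p. p) \<in> carrier P \<rightarrow> carrier P" by simp
  note eh = P.lin_ext_hom[OF t]
  have e: "P.lin_ext (\<lambda>p. p) \<in> mod_epi R ?F P0"
  proof -
    have "\<exists>c\<in>carrier ?F. P.lin_ext (\<lambda>p. p) c = p" if "p \<in> carrier P" for p
      by (rule P.lin_ext_basis[OF t that])
    then have "P.lin_ext (\<lambda>p. p) ` carrier ?F = carrier P"
      using mod_homD(1)[OF eh] by (auto simp: image_iff)
    then show ?thesis using eh by (simp add: mod_epi_def mod_hom_def P0_simps)
  qed
  have id: "(\<lambda>p. p) \<in> mod_hom R P P0" by (auto simp: mod_hom_def P0_simps)
  have "lifts_along R P ?F P0"
    using P P0 F.right_module_axioms unfolding projective_module_def by simp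
  note lift = this[unfolded lifts_along_def]
  have "\<exists>h\<in>mod_hom R P ?F. \<forall>p\<in>carrier P. P.lin_ext (\<lambda>p. p) (h p) = p"
    using lift e id by auto
  then obtain \<sigma> where \<sigma>: "\<sigma> \<in> mod_hom R P ?F" "\<And>p. p \<in> carrier P \<Longrightarrow> P.lin_ext (\<lambda>p. p) (\<sigma> p) = p"
    by auto
  have "\<exists>x. x \<in> carrier X \<and> f x = g p" if "p \<in> carrier P" for p
  proof -
    have "f ` carrier X = carrier Y" using f by (simp add: mod_epi_def)
    then have "g p \<in> f ` carrier X" using mod_homD(1)[OF g that] by simp
    then show ?thesis by auto
  qed
  then obtain t where t: "\<And>p. p \<in> carrier P \<Longrightarrow> t p \<in> carrier X" "\<And>p. p \<in> carrier P \<Longrightarrow> f (t p) = g p"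
    by metis
  have fh: "f \<in> mod_hom R X Y" using f by (simp add: mod_epi_def)
  have tX: "t \<in> carrier P \<rightarrow> carrier X" using t(1) by auto
  note H = X.lin_ext_hom[OF tX]
  have eq: "f (X.lin_ext t c) = g (P.lin_ext (\<lambda>p. p) c)" if c: "c \<in> carrier ?F" for c
  proof -
    let ?T = "{s. c s \<noteq> \<zero>\<^bsub>R\<^esub>}"
    have T: "finite ?T" "?T \<subseteq> carrier P" and cR: "\<And>s. c s \<in> carrier R"
      using c by (auto simp: free_right_module_def)
    have "f (X.lin_ext t c) = (\<Oplus>\<^bsub>Y\<^esub>s\<in>?T. f (c s \<odot>\<^bsub>X\<^esub> t s))"
      unfolding X.lin_ext_def using T cR t(1) by (intro mod_hom_finsum[OF X Y fh]) auto
    also have "\<dots> = (\<Oplus>\<^bsub>Y\<^esub>s\<in>?T. g (c s \<odot>\<^bsub>P\<^esub> s))"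
      using T cR t mod_homD[OF fh] mod_homD[OF g] by (intro Y.M.finsum_cong') (auto simp: subset_iff)
    also have "\<dots> = g (P.lin_ext (\<lambda>p. p) c)"
      unfolding P.lin_ext_def using T cR by (intro mod_hom_finsum[OF P' Y g, symmetric]) auto
    finally show ?thesis .
  qed
  show "\<exists>h\<in>mod_hom R P X. \<forall>p\<in>carrier P. f (h p) = g p"
  proof (intro bexI[of _ "\<lambda>p. X.lin_ext t (\<sigma> p)"] ballI)
    show "f (X.lin_ext t (\<sigma> p)) = g p" if "p \<in> carrier P" for p
      using eq[OF mod_homD(1)[OF \<sigma>(1) that]] \<sigma>(2)[OF that] by simp
    show "(\<lambda>p. X.lin_ext t (\<sigma> p)) \<in> mod_hom R P X"
      using mod_homD[OF H] mod_homD[OF \<sigma>(1)] by (auto simp: mod_hom_def)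
  qed
qed

end

theory Submission
  imports Defs
begin

text \<open>
  Lift \<open>g\<close> along the flat \<open>\<delta>\<close>-cover \<open>f : F \<rightarrow> M\<close> to a map \<open>h : P \<rightarrow> F\<close> with \<open>f h = g\<close>. Then
  \<open>F = Ker f + h(P)\<close>. In the classical situation \<open>Ker f\<close> is small, hence \<open>h\<close> is onto, its kernel is a
  pure submodule of \<open>P\<close> inside the radical and therefore zero, and \<open>g\<close> is isomorphic to \<open>f\<close>. For
  \<open>\<delta>\<close>-smallness both conclusions fail, and each has a weaker substitute.

  \<^item> A \<open>\<delta>\<close>-small submodule can be traded for a direct summand: if \<open>N\<close> is \<open>\<delta>\<close>-small and \<open>N + X\<close> is the
    whole module, then \<open>X\<close> has a complement \<open>Y\<close>
    (\<open>delta_small_complement\<close>). So \<open>F = h(P) \<oplus> Y\<close>, which still leaves \<open>h(P)\<close> flat.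

  \<^item> The kernel \<open>K\<close> of \<open>h\<close> need not vanish, but it lies in every submodule \<open>X\<close> of \<open>P\<close> with \<open>P/X\<close>
    singular (\<open>flat_kernel_in_singular_quotient_kernel\<close>), and this says in particular that \<open>K\<close> is
    \<open>\<delta>\<close>-small. Indeed, let \<open>k \<in> K\<close>. Flatness of \<open>h(P)\<close> makes \<open>K\<close> pure in \<open>P\<close>
    (\<open>flat_kernel_pure\<close>); applied to the coordinates of \<open>k\<close> in a dual basis of \<open>P\<close>, purity produces an
    endomorphism \<open>\<theta>\<close> of \<open>P\<close> which fixes \<open>k\<close> and whose image lies in a finitely generated submodule of
    \<open>K\<close>. As \<open>K \<subseteq> Ker g \<subseteq> \<delta>(P)\<close>, that image lies in a \<open>\<delta>\<close>-small submodule. By the first point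
    \<open>(1 - \<theta>)(P)\<close> is a direct summand of \<open>P\<close>, hence projective, so the fixed points of \<open>\<theta>\<close> form a
    direct summand of \<open>P\<close> as well. A \<open>\<delta>\<close>-small direct summand lies in every \<open>X\<close> with \<open>P/X\<close> singular
    (\<open>fixed_point_in_singular_quotient_kernel\<close>).

  Finally let \<open>Ker g + X = P\<close> with \<open>P/X\<close> singular. Then \<open>W = h(X) + Y\<close> satisfies \<open>Ker f + W = F\<close>, and
  \<open>F/W\<close> is a quotient of \<open>P/X\<close>, hence singular. So \<open>W = F\<close>, which means \<open>X + K = P\<close>, and \<open>X = P\<close>
  because \<open>K \<subseteq> X\<close>.
\<close>

section \<open>Submodules and cosets\<close>

context right_module
begin

lemma smult_minus:
  assumes "a \<in> carrier R" "x \<in> carrier M"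
  shows "(\<ominus> a) \<odot>\<^bsub>M\<^esub> x = \<ominus>\<^bsub>M\<^esub> (a \<odot>\<^bsub>M\<^esub> x)" and "a \<odot>\<^bsub>M\<^esub> (\<ominus>\<^bsub>M\<^esub> x) = \<ominus>\<^bsub>M\<^esub> (a \<odot>\<^bsub>M\<^esub> x)"
proof -
  have "(\<ominus> a) \<odot>\<^bsub>M\<^esub> x \<oplus>\<^bsub>M\<^esub> a \<odot>\<^bsub>M\<^esub> x = \<zero>\<^bsub>M\<^esub>"
    using assms smult_l_distr[of "\<ominus> a" a x] by (simp add: R.l_neg)
  then show "(\<ominus> a) \<odot>\<^bsub>M\<^esub> x = \<ominus>\<^bsub>M\<^esub> (a \<odot>\<^bsub>M\<^esub> x)"
    using assms by (intro M.minus_equality[symmetric]) auto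
  have "a \<odot>\<^bsub>M\<^esub> (\<ominus>\<^bsub>M\<^esub> x) \<oplus>\<^bsub>M\<^esub> a \<odot>\<^bsub>M\<^esub> x = \<zero>\<^bsub>M\<^esub>"
    using assms smult_r_distr[of a "\<ominus>\<^bsub>M\<^esub> x" x] by (simp add: M.l_neg)
  then show "a \<odot>\<^bsub>M\<^esub> (\<ominus>\<^bsub>M\<^esub> x) = \<ominus>\<^bsub>M\<^esub> (a \<odot>\<^bsub>M\<^esub> x)"
    using assms by (intro M.minus_equality[symmetric]) auto
qed

lemma submoduleI:
  assumes "H \<subseteq> carrier M" "\<zero>\<^bsub>M\<^esub> \<in> H"
    and "\<And>x y. x \<in> H \<Longrightarrow> y \<in> H \<Longrightarrow> x \<oplus>\<^bsub>M\<^esub> y \<in> H"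
    and "\<And>a x. a \<in> carrier R \<Longrightarrow> x \<in> H \<Longrightarrow> a \<odot>\<^bsub>M\<^esub> x \<in> H"
  shows "submodule H R M"
proof -
  have "\<ominus>\<^bsub>M\<^esub> x \<in> H" if "x \<in> H" for x
    using assms(4)[of "\<ominus> \<one>" x] assms(1) that by (auto simp: smult_minus)
  then show ?thesis
    using assms by (intro submodule.intro subgroup.intro submodule_axioms.intro) (auto simp: a_inv_def)
qed

lemma submoduleD:
  assumes "submodule H R M"
  shows "\<And>x. x \<in> H \<Longrightarrow> x \<in> carrier M" and "\<zero>\<^bsub>M\<^esub> \<in> H"
    and "\<And>x y. x \<in> H \<Longrightarrow> y \<in> H \<Longrightarrow> x \<oplus>\<^bsub>M\<^esub> y \<in> H"
    and "\<And>x. x \<in> H \<Longrightarrow> \<ominus>\<^bsub>M\<^esub> x \<in> H"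
    and "\<And>x y. x \<in> H \<Longrightarrow> y \<in> H \<Longrightarrow> x \<ominus>\<^bsub>M\<^esub> y \<in> H"
    and "\<And>a x. a \<in> carrier R \<Longrightarrow> x \<in> H \<Longrightarrow> a \<odot>\<^bsub>M\<^esub> x \<in> H"
proof -
  interpret H: submodule H R M by fact
  show cl: "x \<in> carrier M" if "x \<in> H" for x using that H.subset by auto
  show neg: "\<ominus>\<^bsub>M\<^esub> x \<in> H" if "x \<in> H" for x
    using H.m_inv_closed[OF that] by (simp add: a_inv_def)
  show "\<zero>\<^bsub>M\<^esub> \<in> H" "\<And>x y. x \<in> H \<Longrightarrow> y \<in> H \<Longrightarrow> x \<oplus>\<^bsub>M\<^esub> y \<in> H"
    using H.one_closed H.m_closed by auto
  then show "\<And>x y. x \<in> H \<Longrightarrow> y \<in> H \<Longrightarrow> x \<ominus>\<^bsub>M\<^esub> y \<in> H" by (simp add: a_minus_def neg)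
  show "\<And>a x. a \<in> carrier R \<Longrightarrow> x \<in> H \<Longrightarrow> a \<odot>\<^bsub>M\<^esub> x \<in> H" by (rule H.smult_closed)
qed

lemma submodule_finsum:
  assumes "submodule H R M" "finite S" "x \<in> S \<rightarrow> H"
  shows "finsum M x S \<in> H"
  using assms(2,3)
proof (induction S)
  case (insert s S)
  then have "x \<in> S \<rightarrow> carrier M" "x s \<in> carrier M" "x s \<in> H" "finsum M x S \<in> H"
    using submoduleD(1)[OF assms(1)] by auto
  then show ?case using insert(1,2) submoduleD(3)[OF assms(1)] by simp
qed (simp add: submoduleD(2)[OF assms(1)])

lemma mem_set_add: "x \<in> H <+>\<^bsub>M\<^esub> K \<longleftrightarrow> (\<exists>h\<in>H. \<exists>k\<in>K. x = h \<oplus>\<^bsub>M\<^esub> k)"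
  by (auto simp: set_add_def')

lemma submodule_set_add:
  assumes H: "submodule H R M" and K: "submodule K R M"
  shows "submodule (H <+>\<^bsub>M\<^esub> K) R M" and "H \<subseteq> H <+>\<^bsub>M\<^esub> K" and "K \<subseteq> H <+>\<^bsub>M\<^esub> K"
proof -
  note HD = submoduleD[OF H] and KD = submoduleD[OF K]
  show "submodule (H <+>\<^bsub>M\<^esub> K) R M"
  proof (rule submoduleI)
    fix x y assume "x \<in> H <+>\<^bsub>M\<^esub> K" "y \<in> H <+>\<^bsub>M\<^esub> K"
    then obtain a b c d where "a \<in> H" "b \<in> K" "x = a \<oplus>\<^bsub>M\<^esub> b" "c \<in> H" "d \<in> K" "y = c \<oplus>\<^bsub>M\<^esub> d"
      by (auto simp: mem_set_add)
    then show "x \<oplus>\<^bsub>M\<^esub> y \<in> H <+>\<^bsub>M\<^esub> K"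
      unfolding mem_set_add using HD(1,3) KD(1,3)
      by (intro bexI[of _ "a \<oplus>\<^bsub>M\<^esub> c"] bexI[of _ "b \<oplus>\<^bsub>M\<^esub> d"]) (auto simp: M.a_ac)
  next
    fix a x assume "a \<in> carrier R" "x \<in> H <+>\<^bsub>M\<^esub> K"
    then show "a \<odot>\<^bsub>M\<^esub> x \<in> H <+>\<^bsub>M\<^esub> K"
      unfolding mem_set_add using HD(1,6) KD(1,6) by (fastforce simp: smult_r_distr)
  next
    show "\<zero>\<^bsub>M\<^esub> \<in> H <+>\<^bsub>M\<^esub> K" unfolding mem_set_add
      by (intro bexI[OF _ HD(2)] bexI[OF _ KD(2)]) simp
  qed (use HD(1) KD(1) in \<open>auto simp: mem_set_add\<close>)
  have "x = x \<oplus>\<^bsub>M\<^esub> \<zero>\<^bsub>M\<^esub>" if "x \<in> H" for x using HD(1)[OF that] by simp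
  then show "H \<subseteq> H <+>\<^bsub>M\<^esub> K" unfolding mem_set_add subset_eq using KD(2) by blast
  have "x = \<zero>\<^bsub>M\<^esub> \<oplus>\<^bsub>M\<^esub> x" if "x \<in> K" for x using KD(1)[OF that] by simp
  then show "K \<subseteq> H <+>\<^bsub>M\<^esub> K" unfolding mem_set_add subset_eq using HD(2) by blast
qed

lemma coset_eq_iff:
  assumes K: "submodule K R M" and "x \<in> carrier M" "y \<in> carrier M"
  shows "K +>\<^bsub>M\<^esub> x = K +>\<^bsub>M\<^esub> y \<longleftrightarrow> x \<ominus>\<^bsub>M\<^esub> y \<in> K"
proof -
  interpret K: submodule K R M by fact
  interpret Ka: abelian_subgroup K M
    by (intro abelian_subgroupI3 additive_subgroupI K.subgroup_axioms M.abelian_group_axioms)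
  have "K +>\<^bsub>M\<^esub> x = K +>\<^bsub>M\<^esub> y \<longleftrightarrow> x \<in> K +>\<^bsub>M\<^esub> y"
    using Ka.a_rcos_self[OF assms(2)] Ka.a_repr_independence'[OF _ assms(3), of x] by metis
  also have "\<dots> \<longleftrightarrow> x \<ominus>\<^bsub>M\<^esub> y \<in> K" unfolding M.minus_eq by (rule Ka.a_rcos_module[OF assms(3,2)])
  finally show ?thesis .
qed

lemma quot_module_simps:
  assumes K: "submodule K R M"
  shows "carrier (quot_module M K) = (\<lambda>x. K +>\<^bsub>M\<^esub> x) ` carrier M"
    and "\<zero>\<^bsub>quot_module M K\<^esub> = K +>\<^bsub>M\<^esub> \<zero>\<^bsub>M\<^esub>"
    and "x \<in> carrier M \<Longrightarrow> y \<in> carrier M \<Longrightarrow>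
      (K +>\<^bsub>M\<^esub> x) \<oplus>\<^bsub>quot_module M K\<^esub> (K +>\<^bsub>M\<^esub> y) = K +>\<^bsub>M\<^esub> (x \<oplus>\<^bsub>M\<^esub> y)"
proof -
  interpret K: submodule K R M by fact
  interpret Ka: abelian_subgroup K M
    by (intro abelian_subgroupI3 additive_subgroupI K.subgroup_axioms M.abelian_group_axioms)
  show "carrier (quot_module M K) = (\<lambda>x. K +>\<^bsub>M\<^esub> x) ` carrier M"
    by (auto simp: quot_module_def A_RCOSETS_def')
  show "\<zero>\<^bsub>quot_module M K\<^esub> = K +>\<^bsub>M\<^esub> \<zero>\<^bsub>M\<^esub>"
    using M.a_coset_add_zero[OF K.subset[simplified]] by (simp add: quot_module_def)
  show "(K +>\<^bsub>M\<^esub> x) \<oplus>\<^bsub>quot_module M K\<^esub> (K +>\<^bsub>M\<^esub> y) = K +>\<^bsub>M\<^esub> (x \<oplus>\<^bsub>M\<^esub> y)"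
    if "x \<in> carrier M" "y \<in> carrier M"
    using Ka.a_rcos_sum[OF that] by (simp add: quot_module_def)
qed

end

section \<open>Singular quotients and direct complements\<close>

lemma essential_right_ideal_carrier:
  assumes "essential_right_ideal I R" "a \<in> I"
  shows "a \<in> carrier R"
  using assms additive_subgroup.a_subset
  by (auto simp: essential_right_ideal_def right_ideal_def)

context right_module
begin

lemma singular_quot_iff:
  assumes K: "submodule K R M"
  shows "singular_module R (quot_module M K) \<longleftrightarrow>
    (\<forall>x\<in>carrier M. \<exists>I. essential_right_ideal I R \<and> (\<forall>a\<in>I. a \<odot>\<^bsub>M\<^esub> x \<in> K))"
proof -
  have "a \<odot>\<^bsub>quot_module M K\<^esub> (K +>\<^bsub>M\<^esub> x) = \<zero>\<^bsub>quot_module M K\<^esub> \<longleftrightarrow> a \<odot>\<^bsub>M\<^esub> x \<in> K"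
    if "a \<in> carrier R" "x \<in> carrier M" for a x
    using that quot_module(2)[OF K that] coset_eq_iff[OF K, of "a \<odot>\<^bsub>M\<^esub> x" "\<zero>\<^bsub>M\<^esub>"]
    by (simp add: quot_module_simps[OF K] M.minus_eq M.minus_equality[of "\<zero>\<^bsub>M\<^esub>" "\<zero>\<^bsub>M\<^esub>"])
  then have eq: "(essential_right_ideal I R \<and>
      (\<forall>a\<in>I. a \<odot>\<^bsub>quot_module M K\<^esub> (K +>\<^bsub>M\<^esub> x) = \<zero>\<^bsub>quot_module M K\<^esub>)) \<longleftrightarrow>
      (essential_right_ideal I R \<and> (\<forall>a\<in>I. a \<odot>\<^bsub>M\<^esub> x \<in> K))" if "x \<in> carrier M" for I x
    using that essential_right_ideal_carrier by meson
  show ?thesis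
    unfolding singular_module_def quot_module_simps(1)[OF K] ball_simps
    by (rule ball_cong[OF refl], rule ex_cong1, rule eq)
qed

lemma singular_quot_mono:
  assumes "submodule K R M" "submodule L R M" "K \<subseteq> L" "singular_module R (quot_module M K)"
  shows "singular_module R (quot_module M L)"
  using assms(3,4) unfolding singular_quot_iff[OF assms(1)] singular_quot_iff[OF assms(2)]
  by (meson subsetD)

lemma right_ideal_transporter:
  assumes H: "submodule H R M" and x: "x \<in> carrier M"
  shows "right_ideal {a \<in> carrier R. a \<odot>\<^bsub>M\<^esub> x \<in> H} R"
  unfolding right_ideal_def
proof (intro conjI ballI)
  note HD = submoduleD[OF H]
  show "additive_subgroup {a \<in> carrier R. a \<odot>\<^bsub>M\<^esub> x \<in> H} R"
    using x HD(2,3,4) 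
    by (intro additive_subgroupI subgroup.intro)
      (auto simp: smult_l_distr smult_minus simp flip: a_inv_def)
qed (use x submoduleD(6)[OF H] in \<open>auto simp: smult_assoc_right\<close>)

lemma submodule_smult_ideal:
  assumes J: "right_ideal J R" and x: "x \<in> carrier M"
  shows "submodule ((\<lambda>a. a \<odot>\<^bsub>M\<^esub> x) ` J) R M"
proof -
  interpret J: additive_subgroup J R using J by (simp add: right_ideal_def)
  have JR: "a \<in> carrier R" if "a \<in> J" for a using that J.a_subset by auto
  show ?thesis
  proof (rule submoduleI)
    show "\<zero>\<^bsub>M\<^esub> \<in> (\<lambda>a. a \<odot>\<^bsub>M\<^esub> x) ` J" using x by (intro image_eqI[OF _ J.zero_closed]) simp
    show "y \<oplus>\<^bsub>M\<^esub> z \<in> (\<lambda>a. a \<odot>\<^bsub>M\<^esub> x) ` J"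
      if "y \<in> (\<lambda>a. a \<odot>\<^bsub>M\<^esub> x) ` J" "z \<in> (\<lambda>a. a \<odot>\<^bsub>M\<^esub> x) ` J" for y z
      using that x JR J.a_closed by (auto simp flip: smult_l_distr)
    show "a \<odot>\<^bsub>M\<^esub> y \<in> (\<lambda>a. a \<odot>\<^bsub>M\<^esub> x) ` J" if "a \<in> carrier R" "y \<in> (\<lambda>a. a \<odot>\<^bsub>M\<^esub> x) ` J" for a y
      using that x JR J by (auto simp: right_ideal_def simp flip: smult_assoc_right)
  qed (use x JR in auto)
qed

text \<open>Zorn's lemma: the union of a chain of submodules that meet \<open>X\<close> trivially is another one.\<close>

lemma maximal_complement:
  assumes X: "submodule X R M"
  shows "\<exists>Y. submodule Y R M \<and> X \<inter> Y = {\<zero>\<^bsub>M\<^esub>} \<and>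
    (\<forall>Z. submodule Z R M \<and> X \<inter> Z = {\<zero>\<^bsub>M\<^esub>} \<and> Y \<subseteq> Z \<longrightarrow> Z = Y)"
proof -
  let ?A = "{Y. submodule Y R M \<and> X \<inter> Y = {\<zero>\<^bsub>M\<^esub>}}"
  have "\<exists>Y\<in>?A. \<forall>Z\<in>?A. Y \<subseteq> Z \<longrightarrow> Z = Y"
  proof (rule subset_Zorn_nonempty)
    have "submodule {\<zero>\<^bsub>M\<^esub>} R M" by (rule submoduleI) auto
    then have "{\<zero>\<^bsub>M\<^esub>} \<in> ?A" using submoduleD(2)[OF X] by auto
    then show "?A \<noteq> {}" by blast
    fix C assume C: "C \<noteq> {}" "subset.chain ?A C"
    then have CA: "Y \<in> C \<Longrightarrow> submodule Y R M \<and> X \<inter> Y = {\<zero>\<^bsub>M\<^esub>}" for Y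
      by (auto simp: subset.chain_def)
    note CD = submoduleD[OF CA[THEN conjunct1]]
    have "submodule (\<Union>C) R M"
    proof (rule submoduleI)
      show "x \<oplus>\<^bsub>M\<^esub> y \<in> \<Union>C" if xy: "x \<in> \<Union>C" "y \<in> \<Union>C" for x y
      proof -
        obtain Y Z where YZ: "Y \<in> C" "x \<in> Y" "Z \<in> C" "y \<in> Z" using xy by auto
        then have "Y \<subseteq> Z \<or> Z \<subseteq> Y" using C(2) by (auto simp: subset_chain_def)
        then show ?thesis using YZ CD(3)[of Y x y] CD(3)[of Z x y] by blast
      qed
    next
      obtain Y where Y: "Y \<in> C" using C(1) by blast
      show "\<zero>\<^bsub>M\<^esub> \<in> \<Union>C" using Y CD(2)[OF Y] by blast
    next
      show "a \<odot>\<^bsub>M\<^esub> x \<in> \<Union>C" if "a \<in> carrier R" "x \<in> \<Union>C" for a x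
        using that CD(6) by (meson UnionE UnionI)
    next
      show "\<Union>C \<subseteq> carrier M" using CD(1) by blast
    qed
    then show "\<Union>C \<in> ?A" using CA C(1) by blast
  qed
  then obtain Y where "Y \<in> ?A" "\<forall>Z\<in>?A. Y \<subseteq> Z \<longrightarrow> Z = Y" ..
  then show ?thesis by (intro exI[of _ Y]) auto
qed

text \<open>
  By maximality \<open>E = X \<oplus> Y\<close> is essential, and a quotient by an essential submodule is singular: the
  annihilator \<open>I\<close> of the class of \<open>m\<close> consists of the \<open>a\<close> with \<open>m a \<in> E\<close>, and if a right ideal \<open>J\<close>
  met \<open>I\<close> trivially, \<open>Y + m J\<close> would still meet \<open>X\<close> trivially. Then \<open>m J \<subseteq> Y\<close>, so \<open>J \<subseteq> I\<close> and
  \<open>J = 0\<close>.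
\<close>

lemma maximal_complement_singular:
  assumes X: "submodule X R M" and Y: "submodule Y R M" "X \<inter> Y = {\<zero>\<^bsub>M\<^esub>}"
    and max: "\<And>Z. submodule Z R M \<Longrightarrow> X \<inter> Z = {\<zero>\<^bsub>M\<^esub>} \<Longrightarrow> Y \<subseteq> Z \<Longrightarrow> Z = Y"
  shows "singular_module R (quot_module M (X <+>\<^bsub>M\<^esub> Y))"
proof -
  let ?E = "X <+>\<^bsub>M\<^esub> Y"
  note XD = submoduleD[OF X] and YD = submoduleD[OF Y(1)]
  note E = submodule_set_add[OF X Y(1)]
  have "essential_right_ideal {a \<in> carrier R. a \<odot>\<^bsub>M\<^esub> m \<in> ?E} R" if m: "m \<in> carrier M" for m
    unfolding essential_right_ideal_def
  proof (intro conjI allI impI notI right_ideal_transporter[OF E(1) m], elim conjE)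
    fix J assume J: "right_ideal J R" "J \<noteq> {\<zero>}"
      and zero: "{a \<in> carrier R. a \<odot>\<^bsub>M\<^esub> m \<in> ?E} \<inter> J = {\<zero>}"
    interpret J: additive_subgroup J R using J by (simp add: right_ideal_def)
    have JR: "a \<in> carrier R" if "a \<in> J" for a using that J.a_subset by auto
    have J0: "a = \<zero>" if "a \<in> J" "a \<odot>\<^bsub>M\<^esub> m \<in> ?E" for a
      using zero that JR by blast
    let ?mJ = "(\<lambda>a. a \<odot>\<^bsub>M\<^esub> m) ` J"
    note mJ = submodule_smult_ideal[OF J(1) m]
    note S = submodule_set_add[OF Y(1) mJ]
    have "X \<inter> (Y <+>\<^bsub>M\<^esub> ?mJ) = {\<zero>\<^bsub>M\<^esub>}"
    proof (intro equalityI subsetI)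
      fix x assume x: "x \<in> X \<inter> (Y <+>\<^bsub>M\<^esub> ?mJ)"
      then obtain y a where y: "y \<in> Y" "a \<in> J" "x = y \<oplus>\<^bsub>M\<^esub> a \<odot>\<^bsub>M\<^esub> m" "x \<in> X"
        by (auto simp: mem_set_add)
      have "a \<odot>\<^bsub>M\<^esub> m = x \<oplus>\<^bsub>M\<^esub> \<ominus>\<^bsub>M\<^esub> y"
        using y(3) YD(1)[OF y(1)] JR[OF y(2)] m by (simp add: M.a_ac M.r_neg1 M.r_neg2)
      then have "a = \<zero>" using J0 y YD(4) by (auto simp: mem_set_add)
      then show "x \<in> {\<zero>\<^bsub>M\<^esub>}" using y m YD(1) Y(2) by auto
    qed (use XD(2) submoduleD(2)[OF S(1)] in auto)
    from max[OF S(1) this S(2)] S(3) E(3) have "?mJ \<subseteq> ?E" by auto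
    then have "J \<subseteq> {\<zero>}" using J0 by auto
    then show False using J(2) J.zero_closed by auto
  qed
  then show ?thesis unfolding singular_quot_iff[OF E(1)] by blast
qed

section \<open>\<open>\<delta>\<close>-small submodules\<close>

lemma delta_smallD:
  assumes "delta_small R M N"
  shows "submodule N R M"
    and "\<And>K. submodule K R M \<Longrightarrow> singular_module R (quot_module M K) \<Longrightarrow>
      N <+>\<^bsub>M\<^esub> K = carrier M \<Longrightarrow> K = carrier M"
  using assms by (auto simp: delta_small_def)

text \<open>
  For a maximal \<open>Y\<close> that meets \<open>X\<close> trivially, \<open>M/(X + Y)\<close> is singular, so \<open>N + (X + Y) = M\<close> already
  forces \<open>X + Y = M\<close>.
\<close>

lemma delta_small_complement:
  assumes N: "delta_small R M N" and X: "submodule X R M" and NX: "carrier M \<subseteq> N <+>\<^bsub>M\<^esub> X"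
  obtains Y where "submodule Y R M" "X \<inter> Y = {\<zero>\<^bsub>M\<^esub>}" "X <+>\<^bsub>M\<^esub> Y = carrier M"
proof -
  obtain Y where Y: "submodule Y R M" "X \<inter> Y = {\<zero>\<^bsub>M\<^esub>}"
      "\<And>Z. submodule Z R M \<Longrightarrow> X \<inter> Z = {\<zero>\<^bsub>M\<^esub>} \<Longrightarrow> Y \<subseteq> Z \<Longrightarrow> Z = Y"
    using maximal_complement[OF X] by (elim exE conjE) simp
  note E = submodule_set_add[OF X Y(1)]
  have "N <+>\<^bsub>M\<^esub> X \<subseteq> N <+>\<^bsub>M\<^esub> (X <+>\<^bsub>M\<^esub> Y)" using E(2) by (fastforce simp: mem_set_add)
  moreover have "N <+>\<^bsub>M\<^esub> (X <+>\<^bsub>M\<^esub> Y) \<subseteq> carrier M"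
    using submoduleD(1)[OF submodule_set_add(1)[OF delta_smallD(1)[OF N] E(1)]] by auto
  ultimately have "X <+>\<^bsub>M\<^esub> Y = carrier M"
    using NX by (intro delta_smallD(2)[OF N E(1)] maximal_complement_singular[OF X Y]) auto
  then show thesis using that Y by blast
qed

lemma delta_small_zero: "delta_small R M {\<zero>\<^bsub>M\<^esub>}"
proof -
  have "submodule {\<zero>\<^bsub>M\<^esub>} R M" by (rule submoduleI) auto
  moreover have "{\<zero>\<^bsub>M\<^esub>} <+>\<^bsub>M\<^esub> K = K" if "submodule K R M" for K
    using submoduleD(1)[OF that] by (force simp: mem_set_add)
  ultimately show ?thesis by (auto simp: delta_small_def)
qed

lemma delta_small_set_add:
  assumes N: "delta_small R M N" and L: "delta_small R M L"
  shows "delta_small R M (N <+>\<^bsub>M\<^esub> L)"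
  unfolding delta_small_def
proof (intro conjI allI impI notI submodule_set_add(1) delta_smallD(1)[OF N] delta_smallD(1)[OF L],
    elim conjE)
  note NM = delta_smallD(1)[OF N] and LM = delta_smallD(1)[OF L]
  fix K assume K: "submodule K R M" "K \<noteq> carrier M" "singular_module R (quot_module M K)"
    and eq: "N <+>\<^bsub>M\<^esub> L <+>\<^bsub>M\<^esub> K = carrier M"
  note LK = submodule_set_add[OF LM K(1)]
  have "N <+>\<^bsub>M\<^esub> L <+>\<^bsub>M\<^esub> K = N <+>\<^bsub>M\<^esub> (L <+>\<^bsub>M\<^esub> K)"
    using submoduleD(1)[OF NM] submoduleD(1)[OF LM] submoduleD(1)[OF K(1)]
    unfolding set_add_def by (intro M.add.set_mult_assoc) auto
  then have "L <+>\<^bsub>M\<^esub> K = carrier M"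
    using eq by (intro delta_smallD(2)[OF N LK(1)] singular_quot_mono[OF K(1) LK(1) LK(3) K(3)]) simp
  then show False using delta_smallD(2)[OF L K(1,3)] K(2) by simp
qed

lemma finite_delta_small_cover:
  assumes "finite \<F>" "\<And>N. N \<in> \<F> \<Longrightarrow> delta_small R M N"
  shows "\<exists>L. delta_small R M L \<and> \<Union>\<F> \<subseteq> L"
  using assms
proof (induction \<F>)
  case (insert N \<F>)
  then obtain L where L: "delta_small R M L" "\<Union>\<F> \<subseteq> L" by auto
  have N: "delta_small R M N" using insert.prems by simp
  show ?case
    using delta_small_set_add[OF N L(1)] submodule_set_add(2,3)[OF delta_smallD(1)[OF N] delta_smallD(1)[OF L(1)]] L(2)
    by (intro exI[of _ "N <+>\<^bsub>M\<^esub> L"]) auto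
qed (use delta_small_zero in auto)

text \<open>
  The sum \<open>\<delta>(M)\<close> is in general not \<open>\<delta>\<close>-small itself, but finitely many of its elements involve only
  finitely many summands, and a finite sum of \<open>\<delta>\<close>-small submodules is \<open>\<delta>\<close>-small.
\<close>

lemma finite_subset_delta_submodule:
  assumes T: "finite T" "T \<subseteq> delta_submodule R M"
  shows "\<exists>L. delta_small R M L \<and> T \<subseteq> L"
proof -
  have "\<exists>L. delta_small R M L \<and> t \<in> L" if t: "t \<in> delta_submodule R M" for t
  proof -
    obtain x \<F> where F: "t = finsum M x \<F>" "finite \<F>" "\<F> \<subseteq> {N. delta_small R M N}" "\<forall>N\<in>\<F>. x N \<in> N"
      using t by (auto simp: delta_submodule_def sum_of_submodules_def)
    obtain L where L: "delta_small R M L" "\<Union>\<F> \<subseteq> L" using finite_delta_small_cover[OF F(2)] F(3) by auto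
    have "t \<in> L" unfolding F(1) using F L(2) by (intro submodule_finsum delta_smallD(1)[OF L(1)]) auto
    then show ?thesis using L(1) by blast
  qed
  then obtain \<Lambda> where \<Lambda>: "\<And>t. t \<in> T \<Longrightarrow> delta_small R M (\<Lambda> t) \<and> t \<in> \<Lambda> t" using T(2) by (meson subsetD)
  then obtain L where "delta_small R M L" "\<Union>(\<Lambda> ` T) \<subseteq> L"
    using finite_delta_small_cover[of "\<Lambda> ` T"] T(1) by auto
  then show ?thesis using \<Lambda> by blast
qed

end

section \<open>Kernels and images of homomorphisms\<close>

lemma mod_hom_group:
  assumes "right_module R M" "right_module R N" and h: "h \<in> mod_hom R M N"
  shows "h \<zero>\<^bsub>M\<^esub> = \<zero>\<^bsub>N\<^esub>"
    and "\<And>x. x \<in> carrier M \<Longrightarrow> h (\<ominus>\<^bsub>M\<^esub> x) = \<ominus>\<^bsub>N\<^esub> h x"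
    and "\<And>x y. x \<in> carrier M \<Longrightarrow> y \<in> carrier M \<Longrightarrow> h (x \<ominus>\<^bsub>M\<^esub> y) = h x \<ominus>\<^bsub>N\<^esub> h y"
proof -
  interpret M: right_module R M by fact
  interpret N: right_module R N by fact
  note hD = mod_homD[OF h]
  show zero: "h \<zero>\<^bsub>M\<^esub> = \<zero>\<^bsub>N\<^esub>"
    using hD(2)[of "\<zero>\<^bsub>M\<^esub>" "\<zero>\<^bsub>M\<^esub>"] hD(1)[of "\<zero>\<^bsub>M\<^esub>"] by simp
  show neg: "h (\<ominus>\<^bsub>M\<^esub> x) = \<ominus>\<^bsub>N\<^esub> h x" if x: "x \<in> carrier M" for x
  proof -
    have "h (\<ominus>\<^bsub>M\<^esub> x) \<oplus>\<^bsub>N\<^esub> h x = \<zero>\<^bsub>N\<^esub>"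
      using x hD(2)[of "\<ominus>\<^bsub>M\<^esub> x" x] by (simp add: M.M.l_neg zero)
    then show ?thesis using x hD(1) by (intro N.M.minus_equality[symmetric]) auto
  qed
  show "h (x \<ominus>\<^bsub>M\<^esub> y) = h x \<ominus>\<^bsub>N\<^esub> h y" if "x \<in> carrier M" "y \<in> carrier M" for x y
    using that by (simp add: M.M.minus_eq N.M.minus_eq hD neg)
qed

lemma mod_hom_kernel_image:
  assumes M: "right_module R M" and N: "right_module R N" and h: "h \<in> mod_hom R M N"
  shows "submodule (a_kernel M N h) R M"
    and "submodule X R M \<Longrightarrow> submodule (h ` X) R N"
    and "x \<in> a_kernel M N h \<longleftrightarrow> x \<in> carrier M \<and> h x = \<zero>\<^bsub>N\<^esub>"
proof -
  interpret M: right_module R M by fact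
  interpret N: right_module R N by fact
  note hD = mod_homD[OF h]
  note h0 = mod_hom_group(1)[OF M N h]
  show ker: "x \<in> a_kernel M N h \<longleftrightarrow> x \<in> carrier M \<and> h x = \<zero>\<^bsub>N\<^esub>" for x
    by (auto simp: a_kernel_def')
  show "submodule (a_kernel M N h) R M"
    by (rule M.submoduleI) (auto simp: ker hD h0)
  show "submodule (h ` X) R N" if X: "submodule X R M"
  proof (rule N.submoduleI)
    note XD = M.submoduleD[OF X]
    show "h ` X \<subseteq> carrier N" using XD(1) hD(1) by auto
    show "\<zero>\<^bsub>N\<^esub> \<in> h ` X" using imageI[OF XD(2), of h] by (simp add: h0)
    show "x \<oplus>\<^bsub>N\<^esub> y \<in> h ` X" if xy: "x \<in> h ` X" "y \<in> h ` X" for x y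
    proof -
      obtain u v where uv: "u \<in> X" "x = h u" "v \<in> X" "y = h v" using xy by auto
      have "x \<oplus>\<^bsub>N\<^esub> y = h (u \<oplus>\<^bsub>M\<^esub> v)" using uv XD(1) hD(2) by simp
      then show ?thesis using XD(3)[OF uv(1,3)] by (rule image_eqI)
    qed
    show "a \<odot>\<^bsub>N\<^esub> x \<in> h ` X" if ax: "a \<in> carrier R" "x \<in> h ` X" for a x
    proof -
      obtain u where u: "u \<in> X" "x = h u" using ax by auto
      have "a \<odot>\<^bsub>N\<^esub> x = h (a \<odot>\<^bsub>M\<^esub> u)" using u XD(1) hD(3) ax(1) by simp
      then show ?thesis using XD(6)[OF ax(1) u(1)] by (rule image_eqI)
    qed
  qed
qed

section \<open>Relations in a flat module\<close>

text \<open>The submodules of this module are the left ideals of \<open>R\<close>.\<close>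

definition regular_left_module :: "('r, 'x) ring_scheme \<Rightarrow> ('r, 'r) module"
  where "regular_left_module R =
    \<lparr>carrier = carrier R, mult = mult R, one = one R, zero = zero R, add = add R, smult = mult R\<rparr>"

lemma regular_left_module_simps [simp]:
  "carrier (regular_left_module R) = carrier R" "\<zero>\<^bsub>regular_left_module R\<^esub> = \<zero>\<^bsub>R\<^esub>"
  "add (regular_left_module R) = add R" "smult (regular_left_module R) = mult R"
  by (simp_all add: regular_left_module_def)

lemma (in ring) regular_left_module: "left_module R (regular_left_module R)"
  by (intro left_module.intro left_module_axioms.intro ring_axioms abelian_groupI)
    (auto simp: l_distr r_distr m_assoc a_ac intro: add.l_inv_ex)

text \<open>
  In \<open>M \<otimes> R\<close> one has \<open>\<Sum> x\<^sub>s \<otimes> r\<^sub>s = (\<Sum> x\<^sub>s r\<^sub>s) \<otimes> 1\<close>: move each scalar across the tensor sign and use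
  additivity. This gives the easy half of \<open>M \<otimes> R = M\<close>.
\<close>

lemma (in right_module) sum_tensor_rel_regular:
  assumes "finite S" "x \<in> S \<rightarrow> carrier M" "r \<in> S \<rightarrow> carrier R"
  shows "(\<Sum>s\<in>S. frag_of (x s, r s)) - frag_of (\<Oplus>\<^bsub>M\<^esub>s\<in>S. r s \<odot>\<^bsub>M\<^esub> x s, \<one>)
    \<in> tensor_rel R M (regular_left_module R)"
proof -
  let ?B = "regular_left_module R" and ?T = "tensor_rel R M (regular_left_module R)"
  note cl = tensor_rel_closed[OF R.regular_left_module]
  have addrel: "frag_of (x \<oplus>\<^bsub>M\<^esub> y, a) - frag_of (x, a) - frag_of (y, a) \<in> ?T"
    if "x \<in> carrier M" "y \<in> carrier M" "a \<in> carrier R" for x y a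
    by (rule cl(6)) (use that in \<open>unfold tensor_relations_def regular_left_module_simps, blast\<close>)
  have smrel: "frag_of (a \<odot>\<^bsub>M\<^esub> x, b) - frag_of (x, a \<otimes> b) \<in> ?T"
    if "x \<in> carrier M" "a \<in> carrier R" "b \<in> carrier R" for x a b
    by (rule cl(6)) (use that in \<open>unfold tensor_relations_def regular_left_module_simps, blast\<close>)
  show ?thesis using assms
  proof (induction S)
    case empty
    show ?case using cl(4)[OF addrel[of "\<zero>\<^bsub>M\<^esub>" "\<zero>\<^bsub>M\<^esub>" \<one>]] cl(4) addrel[of "\<zero>\<^bsub>M\<^esub>" "\<zero>\<^bsub>M\<^esub>" \<one>] by simp
  next
    case (insert s S)
    let ?u = "\<Oplus>\<^bsub>M\<^esub>s\<in>S. r s \<odot>\<^bsub>M\<^esub> x s" and ?v = "r s \<odot>\<^bsub>M\<^esub> x s"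
    have mem: "x s \<in> carrier M" "r s \<in> carrier R" "(\<lambda>s. r s \<odot>\<^bsub>M\<^esub> x s) \<in> S \<rightarrow> carrier M"
      using insert.prems by (auto simp: Pi_iff)
    then have u: "?u \<in> carrier M" "?v \<in> carrier M" by auto
    have sum: "(\<Oplus>\<^bsub>M\<^esub>s\<in>insert s S. r s \<odot>\<^bsub>M\<^esub> x s) = ?v \<oplus>\<^bsub>M\<^esub> ?u"
      using insert(1,2) mem u by simp
    have "(\<Sum>s\<in>insert s S. frag_of (x s, r s)) - frag_of (?v \<oplus>\<^bsub>M\<^esub> ?u, \<one>) =
        ((\<Sum>s\<in>S. frag_of (x s, r s)) - frag_of (?u, \<one>))
        - (frag_of (?v \<oplus>\<^bsub>M\<^esub> ?u, \<one>) - frag_of (?v, \<one>) - frag_of (?u, \<one>))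
        - (frag_of (?v, \<one>) - frag_of (x s, r s \<otimes> \<one>))"
      using insert(1,2) mem(2) by (simp add: algebra_simps)
    also have "\<dots> \<in> ?T"
    proof (rule cl(5)[OF cl(5)])
      show "(\<Sum>s\<in>S. frag_of (x s, r s)) - frag_of (?u, \<one>) \<in> ?T"
        using insert.IH insert.prems by simp
    qed (intro addrel smrel u mem R.one_closed)+
    finally show ?case unfolding sum .
  qed
qed

text \<open>
  If \<open>\<Sum> x\<^sub>s r\<^sub>s = 0\<close> in \<open>F\<close>, then \<open>\<Sum> x\<^sub>s \<otimes> r\<^sub>s\<close> vanishes in \<open>F \<otimes> R\<close>. Flatness, applied to the inclusion
  of the left ideal \<open>I\<close> spanned by \<open>T\<close>, makes it vanish in \<open>F \<otimes> I\<close>.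
\<close>

lemma flat_module_relation:
  assumes F: "flat_module R F" and T: "finite T" "T \<subseteq> carrier R"
    and S: "finite S" "x \<in> S \<rightarrow> carrier F" "r \<in> S \<rightarrow> T"
    and sum: "(\<Oplus>\<^bsub>F\<^esub>s\<in>S. r s \<odot>\<^bsub>F\<^esub> x s) = \<zero>\<^bsub>F\<^esub>"
  shows "(\<Sum>s\<in>S. frag_of (x s, r s)) \<in> tensor_rel R F
    (regular_left_module R\<lparr>carrier := left_module.span_set R (regular_left_module R) T\<rparr>)"
proof -
  interpret F: right_module R F using F by (simp add: flat_module_def)
  let ?B = "regular_left_module R"
  note B = F.R.regular_left_module
  interpret B: left_module R ?B by (rule B)
  have T': "T \<subseteq> carrier ?B" using T(2) by simp
  define A where "A = ?B\<lparr>carrier := B.span_set T\<rparr>"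
  note span = B.submodule_span_set[OF T(1) T']
  have A: "left_module R A" unfolding A_def by (rule B.submodule_left_module[OF span(1)])
  have "B.span_set T \<subseteq> carrier ?B"
    using span(1) by (metis submodule_def subgroup.subset partial_object.simps(1) monoid_record_simps)
  then have u: "(\<lambda>a. a) \<in> mod_hom R A ?B" by (auto simp: mod_hom_def A_def)
  let ?z = "\<Sum>s\<in>S. frag_of (x s, r s)"
  have inj: "\<forall>z. Poly_Mapping.keys z \<subseteq> carrier F \<times> carrier A \<and> frag_map (\<lambda>a. a) z \<in> tensor_rel R F ?B
       \<longrightarrow> z \<in> tensor_rel R F A"
    using flat_module_tensor_inj[OF F A B u inj_on_id2] by (simp only: F.tensor_map_inj_iff[OF A B u])
  have "Poly_Mapping.keys ?z \<subseteq> (\<Union>s\<in>S. Poly_Mapping.keys (frag_of (x s, r s) :: _ \<Rightarrow>\<^sub>0 int))"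
    by (rule keys_sum)
  also have "\<dots> \<subseteq> carrier F \<times> carrier A"
    using S span(2) by (auto simp: A_def)
  finally have keys: "Poly_Mapping.keys ?z \<subseteq> carrier F \<times> carrier A" .
  have r: "r \<in> S \<rightarrow> carrier R" using S(3) T(2) by auto
  have "?z - frag_of (\<zero>\<^bsub>F\<^esub>, \<one>\<^bsub>R\<^esub>) \<in> tensor_rel R F ?B"
    using F.sum_tensor_rel_regular[OF S(1,2) r] by (simp only: sum)
  moreover have "- frag_of (\<zero>\<^bsub>F\<^esub>, \<one>\<^bsub>R\<^esub>) \<in> tensor_rel R F ?B"
    using F.sum_tensor_rel_regular[of "{}"] by simp
  ultimately have "?z - frag_of (\<zero>\<^bsub>F\<^esub>, \<one>\<^bsub>R\<^esub>) - - frag_of (\<zero>\<^bsub>F\<^esub>, \<one>\<^bsub>R\<^esub>) \<in> tensor_rel R F ?B"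
    by (rule F.tensor_rel_closed(5)[OF B])
  then have "frag_map (\<lambda>a. a) ?z \<in> tensor_rel R F ?B"
    by (subst frag_map_id) simp_all
  then show ?thesis using inj keys unfolding A_def by blast
qed

section \<open>The kernel of a map onto a flat direct summand is pure\<close>

context right_module
begin

lemma direct_sum_unique:
  assumes X: "submodule X R M" and Y: "submodule Y R M" and XY: "X \<inter> Y = {\<zero>\<^bsub>M\<^esub>}"
    and x: "x \<in> X" "x' \<in> X" and y: "y \<in> Y" "y' \<in> Y" and eq: "x \<oplus>\<^bsub>M\<^esub> y = x' \<oplus>\<^bsub>M\<^esub> y'"
  shows "x = x'"
proof -
  note XD = submoduleD[OF X] and YD = submoduleD[OF Y]
  have c: "x \<in> carrier M" "x' \<in> carrier M" "y \<in> carrier M" "y' \<in> carrier M"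
    using x y XD(1) YD(1) by auto
  have "x \<ominus>\<^bsub>M\<^esub> x' = (x \<oplus>\<^bsub>M\<^esub> y) \<ominus>\<^bsub>M\<^esub> y \<ominus>\<^bsub>M\<^esub> x'"
    using c by (simp add: M.minus_eq M.a_ac M.r_neg M.r_neg1 M.r_neg2)
  also have "\<dots> = (x' \<oplus>\<^bsub>M\<^esub> \<ominus>\<^bsub>M\<^esub> x') \<oplus>\<^bsub>M\<^esub> (y' \<ominus>\<^bsub>M\<^esub> y)"
    unfolding eq using c by (simp add: M.minus_eq M.a_ac)
  also have "\<dots> = y' \<ominus>\<^bsub>M\<^esub> y" using c by (simp add: M.r_neg)
  finally have "x \<ominus>\<^bsub>M\<^esub> x' \<in> X \<inter> Y" using XD(5)[OF x] YD(5)[OF y(2,1)] by simp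
  then have "x \<ominus>\<^bsub>M\<^esub> x' = \<zero>\<^bsub>M\<^esub>" using XY by auto
  then show ?thesis using c M.minus_equality[of x "\<ominus>\<^bsub>M\<^esub> x'"] by (simp add: M.minus_eq)
qed

text \<open>
  For a submodule \<open>K\<close> and a finite \<open>T \<subseteq> R\<close> this is the additive group \<open>K I\<close>, where \<open>I\<close> is the left
  ideal spanned by \<open>T\<close>. It is in general not a submodule, since \<open>I\<close> is not a right ideal.
\<close>

definition combinations :: "'m set \<Rightarrow> 'a set \<Rightarrow> 'm set"
  where "combinations K T = {\<Oplus>\<^bsub>M\<^esub>t\<in>T. t \<odot>\<^bsub>M\<^esub> \<kappa> t |\<kappa>. \<kappa> \<in> T \<rightarrow> K}"

lemma combinations:
  assumes K: "submodule K R M" and T: "finite T" "T \<subseteq> carrier R"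
  shows "\<And>x y. x \<in> combinations K T \<Longrightarrow> y \<in> combinations K T \<Longrightarrow> x \<oplus>\<^bsub>M\<^esub> y \<in> combinations K T"
    and "\<And>b x. b \<in> left_module.span_set R (regular_left_module R) T \<Longrightarrow> x \<in> K \<Longrightarrow>
      b \<odot>\<^bsub>M\<^esub> x \<in> combinations K T"
    and "\<zero>\<^bsub>M\<^esub> \<in> combinations K T"
    and "\<And>x. x \<in> combinations K T \<Longrightarrow> \<ominus>\<^bsub>M\<^esub> x \<in> combinations K T"
proof -
  note KD = submoduleD[OF K]
  interpret B: left_module R "regular_left_module R" by (rule R.regular_left_module)
  have cl: "(\<lambda>t. t \<odot>\<^bsub>M\<^esub> \<kappa> t) \<in> T \<rightarrow> carrier M" if "\<kappa> \<in> T \<rightarrow> K" for \<kappa>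
    using that KD(1) T(2) by auto
  have mem: "x \<in> combinations K T" if "\<kappa> \<in> T \<rightarrow> K" "x = (\<Oplus>\<^bsub>M\<^esub>t\<in>T. t \<odot>\<^bsub>M\<^esub> \<kappa> t)" for x \<kappa>
    unfolding combinations_def using that by blast
  have sub: "combinations K T \<subseteq> carrier M"
    unfolding combinations_def using cl by (auto intro: M.finsum_closed)
  show "x \<oplus>\<^bsub>M\<^esub> y \<in> combinations K T" if xy: "x \<in> combinations K T" "y \<in> combinations K T" for x y
  proof -
    obtain c where c: "c \<in> T \<rightarrow> K" "x = (\<Oplus>\<^bsub>M\<^esub>t\<in>T. t \<odot>\<^bsub>M\<^esub> c t)"
      using xy(1) unfolding combinations_def by blast
    obtain d where d: "d \<in> T \<rightarrow> K" "y = (\<Oplus>\<^bsub>M\<^esub>t\<in>T. t \<odot>\<^bsub>M\<^esub> d t)"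
      using xy(2) unfolding combinations_def by blast
    show ?thesis
    proof (rule mem[of "\<lambda>t. c t \<oplus>\<^bsub>M\<^esub> d t"])
      show "(\<lambda>t. c t \<oplus>\<^bsub>M\<^esub> d t) \<in> T \<rightarrow> K" using c(1) d(1) KD(3) by auto
      show "x \<oplus>\<^bsub>M\<^esub> y = (\<Oplus>\<^bsub>M\<^esub>t\<in>T. t \<odot>\<^bsub>M\<^esub> (c t \<oplus>\<^bsub>M\<^esub> d t))"
        unfolding c(2) d(2) M.finsum_addf[OF cl[OF c(1)] cl[OF d(1)], symmetric]
        using c(1) d(1) KD(1) T(2) by (intro M.finsum_cong') (auto simp: smult_r_distr Pi_iff subset_iff)
    qed
  qed
  have sp: "b \<odot>\<^bsub>M\<^esub> x \<in> combinations K T" if bx: "b \<in> B.span_set T" "x \<in> K" for b x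
  proof -
    obtain c where c: "c \<in> T \<rightarrow> carrier R" "b = (\<Oplus>\<^bsub>regular_left_module R\<^esub>t\<in>T. c t \<otimes> t)"
      using bx(1) unfolding B.span_set_def by auto
    have lin: "(\<Oplus>\<^bsub>regular_left_module R\<^esub>t\<in>A. c t \<otimes> t) \<in> carrier R \<and>
        (\<Oplus>\<^bsub>regular_left_module R\<^esub>t\<in>A. c t \<otimes> t) \<odot>\<^bsub>M\<^esub> x = (\<Oplus>\<^bsub>M\<^esub>t\<in>A. t \<odot>\<^bsub>M\<^esub> (c t \<odot>\<^bsub>M\<^esub> x))"
      if "finite A" "A \<subseteq> T" for A
      using that
    proof (induction A)
      case (insert t A)
      have "(\<lambda>t. c t \<otimes> t) \<in> A \<rightarrow> carrier (regular_left_module R)"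
        "(\<lambda>t. t \<odot>\<^bsub>M\<^esub> (c t \<odot>\<^bsub>M\<^esub> x)) \<in> A \<rightarrow> carrier M" "c t \<in> carrier R" "t \<in> carrier R"
        using insert.prems c(1) T(2) KD(1)[OF bx(2)] by (auto simp: Pi_iff subset_iff)
      then show ?case
        using insert KD(1)[OF bx(2)] by (simp add: smult_l_distr smult_assoc_right)
    qed (use KD(1)[OF bx(2)] in simp)
    show ?thesis
    proof (rule mem[of "\<lambda>t. c t \<odot>\<^bsub>M\<^esub> x"])
      show "(\<lambda>t. c t \<odot>\<^bsub>M\<^esub> x) \<in> T \<rightarrow> K" using c(1) KD(6) bx(2) by auto
      show "b \<odot>\<^bsub>M\<^esub> x = (\<Oplus>\<^bsub>M\<^esub>t\<in>T. t \<odot>\<^bsub>M\<^esub> (c t \<odot>\<^bsub>M\<^esub> x))"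
        using lin[OF T(1) subset_refl] by (simp add: c(2))
    qed
  qed
  then show "\<And>b x. b \<in> left_module.span_set R (regular_left_module R) T \<Longrightarrow> x \<in> K \<Longrightarrow>
      b \<odot>\<^bsub>M\<^esub> x \<in> combinations K T" .
  have sm0: "\<zero>\<^bsub>M\<^esub> = (\<Oplus>\<^bsub>M\<^esub>t\<in>T. t \<odot>\<^bsub>M\<^esub> \<zero>\<^bsub>M\<^esub>)"
    using T(2) by (intro M.add.finprod_one_eqI[symmetric]) auto
  show "\<zero>\<^bsub>M\<^esub> \<in> combinations K T" by (rule mem[OF _ sm0]) (use KD(2) in auto)
  show "\<ominus>\<^bsub>M\<^esub> x \<in> combinations K T" if x: "x \<in> combinations K T" for x
  proof -
    obtain c where c: "c \<in> T \<rightarrow> K" "x = (\<Oplus>\<^bsub>M\<^esub>t\<in>T. t \<odot>\<^bsub>M\<^esub> c t)"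
      using x unfolding combinations_def by blast
    have "\<ominus>\<^bsub>M\<^esub> x = (\<ominus> \<one>) \<odot>\<^bsub>M\<^esub> x" using x sub by (auto simp: smult_minus)
    also have "\<dots> = (\<Oplus>\<^bsub>M\<^esub>t\<in>T. (\<ominus> \<one>) \<odot>\<^bsub>M\<^esub> (t \<odot>\<^bsub>M\<^esub> c t))"
      unfolding c(2) by (rule smult_finsum[OF T(1) _ cl[OF c(1)]]) simp
    also have "\<dots> = (\<Oplus>\<^bsub>M\<^esub>t\<in>T. t \<odot>\<^bsub>M\<^esub> (\<ominus>\<^bsub>M\<^esub> c t))"
      using c(1) KD(1) T(2)
      by (intro M.finsum_cong') (auto simp: smult_minus Pi_iff subset_iff)
    finally show ?thesis by (rule mem[rotated]) (use c(1) KD(4) in auto)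
  qed
qed

text \<open>
  The universal property of the free abelian group on \<open>D\<close>, in the additive notation of modules.
\<close>

lemma frag_eval:
  assumes g: "g ` D \<subseteq> carrier M"
  shows "\<exists>ev. ev 0 = \<zero>\<^bsub>M\<^esub> \<and> (\<forall>p\<in>D. ev (frag_of p) = g p) \<and>
    (\<forall>z. Poly_Mapping.keys z \<subseteq> D \<longrightarrow> ev z \<in> carrier M \<and> ev (- z) = \<ominus>\<^bsub>M\<^esub> ev z) \<and>
    (\<forall>z w. Poly_Mapping.keys z \<subseteq> D \<and> Poly_Mapping.keys w \<subseteq> D \<longrightarrow>
      ev (z + w) = ev z \<oplus>\<^bsub>M\<^esub> ev w \<and> ev (z - w) = ev z \<ominus>\<^bsub>M\<^esub> ev w)"
proof -
  have g': "g ` D \<subseteq> carrier (add_monoid M)" using g by simp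
  obtain ev where ev: "ev \<in> hom (free_Abelian_group D) (add_monoid M)"
    "\<And>p. p \<in> D \<Longrightarrow> ev (frag_of p) = g p"
    by (rule comm_group.free_Abelian_group_universal[OF M.a_comm_group g']) blast
  interpret ev: group_hom "free_Abelian_group D" "add_monoid M" ev
    by (intro group_hom.intro group_hom_axioms.intro ev(1) M.a_group group_free_Abelian_group)
  have cl: "ev z \<in> carrier M" if "Poly_Mapping.keys z \<subseteq> D" for z
    using ev.hom_closed[of z] that by simp
  have add: "ev (z + w) = ev z \<oplus>\<^bsub>M\<^esub> ev w"
    if "Poly_Mapping.keys z \<subseteq> D" "Poly_Mapping.keys w \<subseteq> D" for z w
    using ev.hom_mult[of z w] that by simp
  have neg: "ev (- z) = \<ominus>\<^bsub>M\<^esub> ev z" if "Poly_Mapping.keys z \<subseteq> D" for z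
    using ev.hom_inv[of z] that by (simp add: a_inv_def)
  have diff: "ev (z - w) = ev z \<ominus>\<^bsub>M\<^esub> ev w"
    if "Poly_Mapping.keys z \<subseteq> D" "Poly_Mapping.keys w \<subseteq> D" for z w
    using add[of z "- w"] that by (simp add: neg M.minus_eq)
  show ?thesis using ev(2) cl add neg diff ev.hom_one by (intro exI[of _ ev]) simp
qed

end

text \<open>
  Let \<open>K = Ker h\<close> and let \<open>I\<close> be the left ideal spanned by \<open>T\<close>. An element \<open>k = \<Sum> e\<^sub>s r\<^sub>s\<close> of \<open>K\<close> with
  all \<open>r\<^sub>s \<in> T\<close> belongs to \<open>P I\<close>, and the claim is that it belongs to \<open>K I\<close>. Choose for each \<open>x \<in> F\<close> an
  element \<open>l x\<close> of \<open>P\<close> whose image is the component of \<open>x\<close> in \<open>h(P)\<close>; it is determined modulo \<open>K\<close>, so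
  \<open>(x, b) \<mapsto> (l x) b\<close> induces a homomorphism \<open>F \<otimes> I \<rightarrow> P / K I\<close>. It maps \<open>\<Sum> h(e\<^sub>s) \<otimes> r\<^sub>s\<close> to the class of
  \<open>k\<close>, because \<open>l (h(e\<^sub>s))\<close> agrees with \<open>e\<^sub>s\<close> modulo \<open>K\<close>. But \<open>\<Sum> h(e\<^sub>s) r\<^sub>s = h(k) = 0\<close>, so this tensor
  vanishes by flatness.
\<close>

lemma flat_kernel_pure:
  assumes P: "right_module R P" and F: "flat_module R F" and h: "h \<in> mod_hom R P F"
    and Y: "submodule Y R F" "h ` carrier P \<inter> Y = {\<zero>\<^bsub>F\<^esub>}" "h ` carrier P <+>\<^bsub>F\<^esub> Y = carrier F"
    and T: "finite T" "T \<subseteq> carrier R"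
    and S: "finite S" "e \<in> S \<rightarrow> carrier P" "r \<in> S \<rightarrow> T"
    and k: "(\<Oplus>\<^bsub>P\<^esub>s\<in>S. r s \<odot>\<^bsub>P\<^esub> e s) \<in> a_kernel P F h"
  shows "\<exists>\<kappa>. \<kappa> \<in> T \<rightarrow> a_kernel P F h \<and>
    (\<Oplus>\<^bsub>P\<^esub>s\<in>S. r s \<odot>\<^bsub>P\<^esub> e s) = (\<Oplus>\<^bsub>P\<^esub>t\<in>T. t \<odot>\<^bsub>P\<^esub> \<kappa> t)"
proof -
  have F': "right_module R F" using F by (simp add: flat_module_def)
  interpret P: right_module R P by fact
  interpret F: right_module R F by (rule F')
  note B = P.R.regular_left_module
  interpret B: left_module R "regular_left_module R" by (rule B)
  let ?K = "a_kernel P F h"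
  note hD = mod_homD[OF h]
  note K = mod_hom_kernel_image(1)[OF P F' h] and K_iff = mod_hom_kernel_image(3)[OF P F' h]
  note YD = F.submoduleD[OF Y(1)]
  have "submodule (carrier P) R P" by (rule P.submoduleI) auto
  note hP = mod_hom_kernel_image(2)[OF P F' h this]
  define I where "I = B.span_set T"
  have T': "T \<subseteq> carrier (regular_left_module R)" using T(2) by simp
  note span = B.submodule_span_set[OF T(1) T', folded I_def]
  note Q = P.combinations[OF K T, folded I_def]
  have I: "b \<in> carrier R" if "b \<in> I" for b
    using that submodule.axioms(1)[OF span(1)] subgroup.subset by fastforce
  define A where "A = regular_left_module R\<lparr>carrier := I\<rparr>"
  have A: "left_module R A" unfolding A_def by (rule B.submodule_left_module[OF span(1)])
  have A_simps: "carrier A = I" "add A = add R" "smult A = mult R" by (simp_all add: A_def)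

  \<comment> \<open>\<open>lift x p\<close>: the component of \<open>x\<close> in \<open>h(P)\<close> is \<open>h(p)\<close>. As a relation this is compatible with the
    module operations, and two solutions \<open>p\<close> differ by an element of the kernel.\<close>
  define lift where "lift x p \<longleftrightarrow> p \<in> carrier P \<and> (\<exists>y\<in>Y. x = h p \<oplus>\<^bsub>F\<^esub> y)" for x p
  have lift_ex: "\<exists>p. lift x p" if "x \<in> carrier F" for x
    using that unfolding lift_def Y(3)[symmetric] F.mem_set_add by blast
  have lift_unique: "p \<ominus>\<^bsub>P\<^esub> q \<in> ?K" if "lift x p" "lift x q" for x p q
  proof -
    have pq: "p \<in> carrier P" "q \<in> carrier P" using that by (simp_all add: lift_def)
    obtain y y' where "y \<in> Y" "x = h p \<oplus>\<^bsub>F\<^esub> y" "y' \<in> Y" "x = h q \<oplus>\<^bsub>F\<^esub> y'"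
      using \<open>lift x p\<close> \<open>lift x q\<close> unfolding lift_def by blast
    then have "h p = h q"
      using F.direct_sum_unique[OF hP Y(1,2), of "h p" "h q" y y'] pq by simp
    then show ?thesis
      using pq hD(1) by (simp add: K_iff mod_hom_group(3)[OF P F' h] F.M.minus_eq F.M.r_neg)
  qed
  have lift_add: "lift (x \<oplus>\<^bsub>F\<^esub> x') (p \<oplus>\<^bsub>P\<^esub> p')" if xx: "lift x p" "lift x' p'" for x x' p p'
  proof -
    obtain y y' where y: "y \<in> Y" "x = h p \<oplus>\<^bsub>F\<^esub> y" "y' \<in> Y" "x' = h p' \<oplus>\<^bsub>F\<^esub> y'"
      and p: "p \<in> carrier P" "p' \<in> carrier P" using xx unfolding lift_def by blast
    have "x \<oplus>\<^bsub>F\<^esub> x' = h (p \<oplus>\<^bsub>P\<^esub> p') \<oplus>\<^bsub>F\<^esub> (y \<oplus>\<^bsub>F\<^esub> y')"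
      using y p YD(1) hD(1) by (simp add: hD(2) F.M.a_ac)
    then show ?thesis using p YD(3)[OF y(1,3)] unfolding lift_def by auto
  qed
  have lift_smult: "lift (a \<odot>\<^bsub>F\<^esub> x) (a \<odot>\<^bsub>P\<^esub> p)" if ax: "a \<in> carrier R" "lift x p" for a x p
  proof -
    obtain y where y: "y \<in> Y" "x = h p \<oplus>\<^bsub>F\<^esub> y" and p: "p \<in> carrier P"
      using ax unfolding lift_def by blast
    have "a \<odot>\<^bsub>F\<^esub> x = h (a \<odot>\<^bsub>P\<^esub> p) \<oplus>\<^bsub>F\<^esub> a \<odot>\<^bsub>F\<^esub> y"
      using y p YD(1) hD(1) ax(1) by (simp add: hD(3) F.smult_r_distr)
    then show ?thesis using p ax(1) YD(6)[OF ax(1) y(1)] unfolding lift_def by auto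
  qed
  have lift_h: "lift (h p) p" if "p \<in> carrier P" for p
    unfolding lift_def using that hD(1) by (intro conjI bexI[OF _ YD(2)]) auto
  define l where "l x = (SOME p. lift x p)" for x
  have l: "lift x (l x)" if "x \<in> carrier F" for x
    unfolding l_def by (rule someI_ex[OF lift_ex[OF that]])
  have lP: "l x \<in> carrier P" if "x \<in> carrier F" for x using l[OF that] by (simp add: lift_def)

  \<comment> \<open>\<open>ev\<close> is the map \<open>x \<otimes> b \<mapsto> (l x) b\<close> on formal sums; the tensor relations go to \<open>K I\<close>.\<close>
  let ?D = "carrier F \<times> I"
  have "(\<lambda>(x, b). b \<odot>\<^bsub>P\<^esub> l x) ` ?D \<subseteq> carrier P" using lP I by auto
  from P.frag_eval[OF this] obtain ev where ev0: "ev 0 = \<zero>\<^bsub>P\<^esub>"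
    and ev_of': "\<forall>p\<in>?D. ev (frag_of p) = (case p of (x, b) \<Rightarrow> b \<odot>\<^bsub>P\<^esub> l x)"
    and ev1: "\<forall>z. Poly_Mapping.keys z \<subseteq> ?D \<longrightarrow> ev z \<in> carrier P \<and> ev (- z) = \<ominus>\<^bsub>P\<^esub> ev z"
    and ev2: "\<forall>z w. Poly_Mapping.keys z \<subseteq> ?D \<and> Poly_Mapping.keys w \<subseteq> ?D \<longrightarrow>
      ev (z + w) = ev z \<oplus>\<^bsub>P\<^esub> ev w \<and> ev (z - w) = ev z \<ominus>\<^bsub>P\<^esub> ev w"
    by (elim exE conjE) 
  have ev_of: "ev (frag_of (x, b)) = b \<odot>\<^bsub>P\<^esub> l x" if "x \<in> carrier F" "b \<in> I" for x b
    using ev_of' that by auto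
  have ev_diff: "ev (frag_of (x, b) - frag_of (y, c)) = b \<odot>\<^bsub>P\<^esub> l x \<ominus>\<^bsub>P\<^esub> c \<odot>\<^bsub>P\<^esub> l y"
    if "x \<in> carrier F" "b \<in> I" "y \<in> carrier F" "c \<in> I" for x b y c
    using ev2[rule_format, of "frag_of (x, b)" "frag_of (y, c)"] that by (simp add: ev_of)
  have ev_diff2: "ev (frag_of (x, b) - frag_of (y, c) - frag_of (z, d)) =
      b \<odot>\<^bsub>P\<^esub> l x \<ominus>\<^bsub>P\<^esub> c \<odot>\<^bsub>P\<^esub> l y \<ominus>\<^bsub>P\<^esub> d \<odot>\<^bsub>P\<^esub> l z"
    if m: "x \<in> carrier F" "b \<in> I" "y \<in> carrier F" "c \<in> I" "z \<in> carrier F" "d \<in> I" for x b y c z d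
  proof -
    have "Poly_Mapping.keys (frag_of (x, b) - frag_of (y, c) :: _ \<Rightarrow>\<^sub>0 int) \<subseteq> ?D"
      by (rule order_trans[OF keys_diff]) (use m in auto)
    then show ?thesis
      using ev2[rule_format, of "frag_of (x, b) - frag_of (y, c)" "frag_of (z, d)"] m
      by (simp add: ev_of ev_diff)
  qed
  have rel: "ev w \<in> P.combinations ?K T" if w: "w \<in> tensor_relations R F A" for w
    using w unfolding tensor_relations_def Un_iff mem_Collect_eq A_simps
  proof (elim disjE exE conjE)
    fix x y b assume w: "w = frag_of (x \<oplus>\<^bsub>F\<^esub> y, b) - frag_of (x, b) - frag_of (y, b)"
      and m: "x \<in> carrier F" "y \<in> carrier F" "b \<in> I"
    have "ev w = b \<odot>\<^bsub>P\<^esub> (l (x \<oplus>\<^bsub>F\<^esub> y) \<ominus>\<^bsub>P\<^esub> (l x \<oplus>\<^bsub>P\<^esub> l y))"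
      unfolding w using m I[OF m(3)] lP
      by (simp add: ev_diff2 P.M.minus_eq P.smult_r_distr P.smult_minus P.M.minus_add P.M.a_ac)
    moreover have "l (x \<oplus>\<^bsub>F\<^esub> y) \<ominus>\<^bsub>P\<^esub> (l x \<oplus>\<^bsub>P\<^esub> l y) \<in> ?K"
      by (rule lift_unique[OF l lift_add[OF l l]]) (use m in auto)
    ultimately show ?thesis using Q(2)[OF m(3)] by simp
  next
    fix x b c assume w: "w = frag_of (x, b \<oplus>\<^bsub>R\<^esub> c) - frag_of (x, b) - frag_of (x, c)"
      and m: "x \<in> carrier F" "b \<in> I" "c \<in> I"
    have "b \<oplus>\<^bsub>R\<^esub> c \<in> I"
      using subgroup.m_closed[OF submodule.axioms(1)[OF span(1)] m(2,3)] by simp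
    then have "ev w = (b \<odot>\<^bsub>P\<^esub> l x \<oplus>\<^bsub>P\<^esub> \<ominus>\<^bsub>P\<^esub> (b \<odot>\<^bsub>P\<^esub> l x)) \<oplus>\<^bsub>P\<^esub> (c \<odot>\<^bsub>P\<^esub> l x \<oplus>\<^bsub>P\<^esub> \<ominus>\<^bsub>P\<^esub> (c \<odot>\<^bsub>P\<^esub> l x))"
      unfolding w using m I lP[OF m(1)]
      by (simp add: ev_diff2 P.M.minus_eq P.smult_l_distr P.M.a_ac)
    also have "\<dots> = \<zero>\<^bsub>P\<^esub>" using m I lP[OF m(1)] by (simp add: P.M.r_neg)
    finally show ?thesis using Q(3) by simp
  next
    fix a x b assume w: "w = frag_of (a \<odot>\<^bsub>F\<^esub> x, b) - frag_of (x, a \<otimes>\<^bsub>R\<^esub> b)"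
      and m: "a \<in> carrier R" "x \<in> carrier F" "b \<in> I"
    have "a \<otimes>\<^bsub>R\<^esub> b \<in> I" using submodule.smult_closed[OF span(1) m(1,3)] by simp
    then have "ev w = b \<odot>\<^bsub>P\<^esub> (l (a \<odot>\<^bsub>F\<^esub> x) \<ominus>\<^bsub>P\<^esub> a \<odot>\<^bsub>P\<^esub> l x)"
      unfolding w using m I[OF m(3)] lP
      by (simp add: ev_diff P.M.minus_eq P.smult_r_distr P.smult_minus P.smult_assoc_right)
    moreover have "l (a \<odot>\<^bsub>F\<^esub> x) \<ominus>\<^bsub>P\<^esub> a \<odot>\<^bsub>P\<^esub> l x \<in> ?K"
      by (rule lift_unique[OF l lift_smult[OF m(1) l]]) (use m in auto)
    ultimately show ?thesis using Q(2)[OF m(3)] by simp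
  qed
  have ev_rel: "Poly_Mapping.keys w \<subseteq> ?D \<and> ev w \<in> P.combinations ?K T" if "w \<in> tensor_rel R F A" for w
  proof (rule F.tensor_rel_induct[OF A that], goal_cases)
    case 1
    show ?case using ev0 Q(3) by simp
  next
    case (2 r)
    then show ?case using rel F.tensor_relations_closed[OF A 2] by (simp add: A_simps)
  next
    case (3 r)
    then show ?case using rel F.tensor_relations_closed[OF A 3] ev1 Q(4) by (simp add: A_simps)
  next
    case (4 r s)
    then have rs: "Poly_Mapping.keys r \<subseteq> ?D \<and> Poly_Mapping.keys s \<subseteq> ?D"
      and Q_rs: "ev r \<in> P.combinations ?K T" "ev s \<in> P.combinations ?K T" by simp_all
    have "Poly_Mapping.keys (r + s) \<subseteq> ?D"
      by (rule order_trans[OF keys_add]) (use rs in simp)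
    then show ?case using ev2[rule_format, OF rs] Q(1)[OF Q_rs] by simp
  qed

  \<comment> \<open>Modulo \<open>K I\<close>, \<open>ev\<close> sends \<open>\<Sum> h(e\<^sub>s) \<otimes> r\<^sub>s\<close> to \<open>\<Sum> e\<^sub>s r\<^sub>s\<close>.\<close>
  let ?z = "\<lambda>S. \<Sum>s\<in>S. frag_of (h (e s), r s) :: _ \<Rightarrow>\<^sub>0 int"
  have eS: "e s \<in> carrier P" "r s \<in> I" if "s \<in> S" for s using that S(2,3) span(2) by auto
  have approx: "Poly_Mapping.keys (?z U) \<subseteq> ?D \<and>
      (\<Oplus>\<^bsub>P\<^esub>s\<in>U. r s \<odot>\<^bsub>P\<^esub> e s) \<ominus>\<^bsub>P\<^esub> ev (?z U) \<in> P.combinations ?K T"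
    if "finite U" "U \<subseteq> S" for U
    using that
  proof (induction U)
    case empty
    show ?case using Q(3) by (simp add: ev0 P.M.minus_eq P.M.minus_equality[of "\<zero>\<^bsub>P\<^esub>" "\<zero>\<^bsub>P\<^esub>"])
  next
    case (insert s U)
    then have s: "e s \<in> carrier P" "r s \<in> I" and IH: "Poly_Mapping.keys (?z U) \<subseteq> ?D"
      "(\<Oplus>\<^bsub>P\<^esub>s\<in>U. r s \<odot>\<^bsub>P\<^esub> e s) \<ominus>\<^bsub>P\<^esub> ev (?z U) \<in> P.combinations ?K T"
      using eS by auto
    note hs = hD(1)[OF s(1)]
    have U: "(\<lambda>s. r s \<odot>\<^bsub>P\<^esub> e s) \<in> U \<rightarrow> carrier P" using eS I insert.prems by auto
    have key: "Poly_Mapping.keys (frag_of (h (e s), r s) :: _ \<Rightarrow>\<^sub>0 int) \<subseteq> ?D" using hs s(2) by simp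
    have "ev (frag_of (h (e s), r s) + ?z U) = r s \<odot>\<^bsub>P\<^esub> l (h (e s)) \<oplus>\<^bsub>P\<^esub> ev (?z U)"
      using ev2 key IH(1) ev_of[OF hs s(2)] by simp
    then have "(\<Oplus>\<^bsub>P\<^esub>s\<in>insert s U. r s \<odot>\<^bsub>P\<^esub> e s) \<ominus>\<^bsub>P\<^esub> ev (?z (insert s U)) =
        r s \<odot>\<^bsub>P\<^esub> (e s \<ominus>\<^bsub>P\<^esub> l (h (e s))) \<oplus>\<^bsub>P\<^esub> ((\<Oplus>\<^bsub>P\<^esub>s\<in>U. r s \<odot>\<^bsub>P\<^esub> e s) \<ominus>\<^bsub>P\<^esub> ev (?z U))"
      using insert.hyps s I[OF s(2)] U lP[OF hs] ev1[rule_format, OF IH(1)]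
      by (simp add: P.M.minus_eq P.smult_r_distr P.smult_minus P.M.minus_add P.M.a_ac)
    moreover have "r s \<odot>\<^bsub>P\<^esub> (e s \<ominus>\<^bsub>P\<^esub> l (h (e s))) \<in> P.combinations ?K T"
      by (rule Q(2)[OF s(2) lift_unique[OF lift_h[OF s(1)] l[OF hs]]])
    moreover have "Poly_Mapping.keys (?z (insert s U)) \<subseteq> ?D"
      using insert.hyps key IH(1) keys_add[of "frag_of (h (e s), r s)" "?z U"] by auto
    ultimately show ?case using Q(1)[OF _ IH(2)] by simp
  qed
  have "(\<Oplus>\<^bsub>F\<^esub>s\<in>S. r s \<odot>\<^bsub>F\<^esub> h (e s)) = h (\<Oplus>\<^bsub>P\<^esub>s\<in>S. r s \<odot>\<^bsub>P\<^esub> e s)"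
  proof -
    have "h (\<Oplus>\<^bsub>P\<^esub>s\<in>S. r s \<odot>\<^bsub>P\<^esub> e s) = (\<Oplus>\<^bsub>F\<^esub>s\<in>S. h (r s \<odot>\<^bsub>P\<^esub> e s))"
      using eS I by (intro mod_hom_finsum[OF P F' h S(1)]) auto
    also have "\<dots> = (\<Oplus>\<^bsub>F\<^esub>s\<in>S. r s \<odot>\<^bsub>F\<^esub> h (e s))"
      using eS I hD by (intro F.M.finsum_cong') auto
    finally show ?thesis by simp
  qed
  then have "(\<Oplus>\<^bsub>F\<^esub>s\<in>S. r s \<odot>\<^bsub>F\<^esub> h (e s)) = \<zero>\<^bsub>F\<^esub>" using k by (simp add: K_iff)
  then have "?z S \<in> tensor_rel R F A"
    unfolding A_def I_def using S hD(1) by (intro flat_module_relation[OF F T]) auto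
  then have "((\<Oplus>\<^bsub>P\<^esub>s\<in>S. r s \<odot>\<^bsub>P\<^esub> e s) \<ominus>\<^bsub>P\<^esub> ev (?z S)) \<oplus>\<^bsub>P\<^esub> ev (?z S) \<in> P.combinations ?K T"
    using ev_rel approx[OF S(1) subset_refl] by (intro Q(1)) auto
  moreover have "(\<Oplus>\<^bsub>P\<^esub>s\<in>S. r s \<odot>\<^bsub>P\<^esub> e s) \<in> carrier P" "ev (?z S) \<in> carrier P"
    using k K_iff approx[OF S(1) subset_refl] ev1 by auto
  ultimately have "(\<Oplus>\<^bsub>P\<^esub>s\<in>S. r s \<odot>\<^bsub>P\<^esub> e s) \<in> P.combinations ?K T"
    by (simp add: P.M.minus_eq P.M.a_assoc P.M.l_neg)
  then show ?thesis unfolding P.combinations_def by blast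
qed

section \<open>Projective modules and submodules with singular quotient\<close>

text \<open>
  A splitting \<open>\<sigma>\<close> of the canonical surjection from the free module on the elements of \<open>P\<close> supplies the
  coordinate functions \<open>p \<mapsto> \<sigma> p q\<close>.
\<close>

lemma projective_module_dual_basis:
  assumes P: "projective_module R P"
  shows "\<exists>\<sigma> \<in> mod_hom R P (free_right_module R (carrier P)).
    \<forall>p\<in>carrier P. (\<Oplus>\<^bsub>P\<^esub>q\<in>{q. \<sigma> p q \<noteq> \<zero>\<^bsub>R\<^esub>}. \<sigma> p q \<odot>\<^bsub>P\<^esub> q) = p"
proof -
  interpret P: right_module R P using P by (simp add: projective_module_def)
  let ?F = "free_right_module R (carrier P)" and ?e = "P.lin_ext (\<lambda>p. p)"
  have t: "(\<lambda>p. p) \<in> carrier P \<rightarrow> carrier P" by simp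
  note eh = P.lin_ext_hom[OF t]
  have "p \<in> ?e ` carrier ?F" if "p \<in> carrier P" for p
    using P.lin_ext_basis[OF t that] by force
  then have "?e \<in> mod_epi R ?F P" using eh mod_homD(1)[OF eh] by (auto simp: mod_epi_def)
  moreover have "(\<lambda>p. p) \<in> mod_hom R P P" by (simp add: mod_hom_def)
  moreover have "lifts_along R P ?F P"
    by (rule projective_module_lifts[OF P P.R.free_right_module P.right_module_axioms])
  ultimately have "\<exists>\<sigma>\<in>mod_hom R P ?F. \<forall>p\<in>carrier P. ?e (\<sigma> p) = p"
    unfolding lifts_along_def by fastforce
  then show ?thesis unfolding P.lin_ext_def .
qed

text \<open>
  Put \<open>u = 1 - \<theta>\<close>. As \<open>\<theta>(P) + u(P) = P\<close> and \<open>\<theta>(P) \<subseteq> L\<close> with \<open>L\<close> \<open>\<delta>\<close>-small, \<open>u(P)\<close> is a direct summand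
  of \<open>P\<close>, so \<open>u\<close> splits over its image. Its kernel \<open>D\<close>, the set of fixed points of \<open>\<theta>\<close>, is therefore
  a direct summand too, say \<open>P = D \<oplus> Z\<close>, and \<open>D \<subseteq> \<theta>(P) \<subseteq> L\<close>. The module \<open>P / ((X \<inter> D) \<oplus> Z)\<close> is
  isomorphic to \<open>D / (X \<inter> D)\<close>, which embeds into \<open>P/X\<close> and is singular. Since
  \<open>L + ((X \<inter> D) \<oplus> Z) = P\<close>, it follows that \<open>(X \<inter> D) \<oplus> Z = P\<close>, that is, \<open>D \<subseteq> X\<close>.
\<close>

lemma fixed_point_in_singular_quotient_kernel:
  assumes P: "projective_module R P" and \<theta>: "\<theta> \<in> mod_hom R P P"
    and L: "delta_small R P L" "\<theta> ` carrier P \<subseteq> L"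
    and k: "k \<in> carrier P" "\<theta> k = k"
    and X: "submodule X R P" "singular_module R (quot_module P X)"
  shows "k \<in> X"
proof -
  have P': "right_module R P" using P by (simp add: projective_module_def)
  interpret P: right_module R P by (rule P')
  note \<theta>D = mod_homD[OF \<theta>]
  note XD = P.submoduleD[OF X(1)]
  define u where "u p = p \<ominus>\<^bsub>P\<^esub> \<theta> p" for p
  have u: "u \<in> mod_hom R P P"
    unfolding mod_hom_def u_def using \<theta>D
    by (auto simp: P.M.minus_eq P.M.minus_add P.M.a_ac P.smult_r_distr P.smult_minus)
  note uD = mod_homD[OF u] and uG = mod_hom_group[OF P' P' u]
  have decomp: "p = \<theta> p \<oplus>\<^bsub>P\<^esub> u p" if "p \<in> carrier P" for p
    using that \<theta>D(1)[OF that] unfolding u_def P.M.minus_eq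
    by (simp add: P.M.a_lcomm[of "\<theta> p" p] P.M.r_neg)
  have fixed: "\<theta> p = p" if "p \<in> carrier P" "u p = \<zero>\<^bsub>P\<^esub>" for p
    using decomp[OF that(1)] that \<theta>D(1)[OF that(1)] by simp
  let ?U = "u ` carrier P"
  have "submodule (carrier P) R P" by (rule P.submoduleI) auto
  note U = mod_hom_kernel_image(2)[OF P' P' u this]
  have "carrier P \<subseteq> L <+>\<^bsub>P\<^esub> ?U"
  proof
    fix p assume p: "p \<in> carrier P"
    then have "\<theta> p \<in> L" "u p \<in> ?U" using L(2) by auto
    then show "p \<in> L <+>\<^bsub>P\<^esub> ?U" unfolding P.mem_set_add using decomp[OF p] by blast
  qed
  then obtain Y where Y: "submodule Y R P" "?U \<inter> Y = {\<zero>\<^bsub>P\<^esub>}" "?U <+>\<^bsub>P\<^esub> Y = carrier P"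
    by (rule P.delta_small_complement[OF L(1) U])
  note YD = P.submoduleD[OF Y(1)]
  \<comment> \<open>\<open>P/Y\<close> is isomorphic to \<open>u(P)\<close>; \<open>s\<close> lifts the projection onto \<open>u(P)\<close> along \<open>u\<close>, and \<open>u s u = u\<close>.\<close>
  let ?Q = "quot_module P Y"
  note Q = P.quot_module[OF Y(1)] and Q_simps = P.quot_module_simps[OF Y(1)]
  have can: "(\<lambda>p. Y +>\<^bsub>P\<^esub> p) \<in> mod_hom R P ?Q"
    unfolding mod_hom_def using Q(2) Q_simps(1,3) by auto
  have uQ: "(\<lambda>p. Y +>\<^bsub>P\<^esub> u p) \<in> mod_hom R P ?Q"
    unfolding mod_hom_def using Q(2) Q_simps(1,3) uD by auto
  have "Y +>\<^bsub>P\<^esub> p \<in> (\<lambda>p. Y +>\<^bsub>P\<^esub> u p) ` carrier P" if p: "p \<in> carrier P" for p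
  proof -
    have "p \<in> ?U <+>\<^bsub>P\<^esub> Y" using p Y(3) by simp
    then obtain q y where q: "q \<in> carrier P" "y \<in> Y" "p = u q \<oplus>\<^bsub>P\<^esub> y"
      unfolding P.mem_set_add by blast
    have "p \<ominus>\<^bsub>P\<^esub> u q = y"
      using q(3) uD(1)[OF q(1)] YD(1)[OF q(2)]
      by (simp add: P.M.minus_eq P.M.a_ac P.M.r_neg P.M.r_neg1 P.M.r_neg2)
    then have "Y +>\<^bsub>P\<^esub> p = Y +>\<^bsub>P\<^esub> u q"
      using P.coset_eq_iff[OF Y(1) p uD(1)[OF q(1)]] q(2) by simp
    then show ?thesis using q(1) by blast
  qed
  then have "(\<lambda>p. Y +>\<^bsub>P\<^esub> u p) \<in> mod_epi R P ?Q"
    using uQ mod_homD(1)[OF uQ] unfolding mod_epi_def Q_simps(1) by auto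
  moreover have "lifts_along R P P ?Q" by (rule projective_module_lifts[OF P P' Q(1)])
  ultimately obtain s where s: "s \<in> mod_hom R P P"
    and us: "\<And>p. p \<in> carrier P \<Longrightarrow> Y +>\<^bsub>P\<^esub> u (s p) = Y +>\<^bsub>P\<^esub> p"
    using can unfolding lifts_along_def by meson
  note sD = mod_homD[OF s]
  have usu: "u (s (u p)) = u p" if p: "p \<in> carrier P" for p
  proof -
    note c = uD(1)[OF p] uD(1)[OF sD(1)[OF uD(1)[OF p]]]
    have "u (s (u p)) \<ominus>\<^bsub>P\<^esub> u p \<in> Y"
      using P.coset_eq_iff[OF Y(1) c(2,1)] us[OF c(1)] by simp
    moreover have "u (s (u p)) \<ominus>\<^bsub>P\<^esub> u p \<in> ?U"
      using P.submoduleD(5)[OF U] p sD(1) uD(1) by simp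
    ultimately have "u (s (u p)) \<ominus>\<^bsub>P\<^esub> u p = \<zero>\<^bsub>P\<^esub>" using Y(2) by blast
    then show ?thesis
      using c P.M.minus_equality[of "u (s (u p))" "\<ominus>\<^bsub>P\<^esub> u p"] by (simp add: P.M.minus_eq)
  qed
  \<comment> \<open>\<open>P = D \<oplus> Z\<close>, with \<open>s u\<close> as the projection onto \<open>Z\<close>.\<close>
  let ?D = "a_kernel P P u" and ?Z = "s ` ?U"
  note D = mod_hom_kernel_image(1)[OF P' P' u] and D_iff = mod_hom_kernel_image(3)[OF P' P' u]
  note Z = mod_hom_kernel_image(2)[OF P' P' s U]
  have split: "p \<ominus>\<^bsub>P\<^esub> s (u p) \<in> ?D \<and> p = (p \<ominus>\<^bsub>P\<^esub> s (u p)) \<oplus>\<^bsub>P\<^esub> s (u p)" if p: "p \<in> carrier P" for p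
  proof -
    have c: "u p \<in> carrier P" "s (u p) \<in> carrier P" using p uD(1) sD(1) by auto
    then have "u (p \<ominus>\<^bsub>P\<^esub> s (u p)) = u p \<ominus>\<^bsub>P\<^esub> u p" using p by (simp add: uG(3) usu)
    then have "u (p \<ominus>\<^bsub>P\<^esub> s (u p)) = \<zero>\<^bsub>P\<^esub>" using c by (simp add: P.M.minus_eq P.M.r_neg)
    then show ?thesis using c p by (simp add: D_iff P.M.minus_eq P.M.a_assoc P.M.l_neg)
  qed
  note DD = P.submoduleD[OF D] and ZD = P.submoduleD[OF Z]
  have XDm: "submodule (X \<inter> ?D) R P"
    by (rule P.submoduleI) (use XD DD in auto)
  let ?X' = "(X \<inter> ?D) <+>\<^bsub>P\<^esub> ?Z"
  note X' = P.submodule_set_add[OF XDm Z]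
  have "singular_module R (quot_module P ?X')"
    unfolding P.singular_quot_iff[OF X'(1)]
  proof
    fix p assume p: "p \<in> carrier P"
    let ?d = "p \<ominus>\<^bsub>P\<^esub> s (u p)"
    have d: "?d \<in> ?D" "?d \<in> carrier P" using split[OF p] DD(1) by auto
    obtain I where I: "essential_right_ideal I R" "\<forall>a\<in>I. a \<odot>\<^bsub>P\<^esub> ?d \<in> X"
      using X(2) d(2) unfolding P.singular_quot_iff[OF X(1)] by blast
    note IR = essential_right_ideal_carrier[OF I(1)]
    have "a \<odot>\<^bsub>P\<^esub> p \<in> ?X'" if a: "a \<in> I" for a
    proof -
      have "a \<odot>\<^bsub>P\<^esub> p = a \<odot>\<^bsub>P\<^esub> (?d \<oplus>\<^bsub>P\<^esub> s (u p))" using split[OF p] by simp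
      also have "\<dots> = a \<odot>\<^bsub>P\<^esub> ?d \<oplus>\<^bsub>P\<^esub> a \<odot>\<^bsub>P\<^esub> s (u p)"
        using IR[OF a] d(2) p uD(1) sD(1) by (intro P.smult_r_distr) auto
      finally have "a \<odot>\<^bsub>P\<^esub> p = a \<odot>\<^bsub>P\<^esub> ?d \<oplus>\<^bsub>P\<^esub> a \<odot>\<^bsub>P\<^esub> s (u p)" .
      moreover have "a \<odot>\<^bsub>P\<^esub> ?d \<in> X \<inter> ?D" using I(2) a DD(6)[OF IR[OF a] d(1)] by blast
      moreover have "a \<odot>\<^bsub>P\<^esub> s (u p) \<in> ?Z" using ZD(6)[OF IR[OF a]] p by blast
      ultimately show ?thesis unfolding P.mem_set_add by blast
    qed
    then show "\<exists>I. essential_right_ideal I R \<and> (\<forall>a\<in>I. a \<odot>\<^bsub>P\<^esub> p \<in> ?X')" using I(1) by blast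
  qed
  moreover have "L <+>\<^bsub>P\<^esub> ?X' = carrier P"
  proof (intro equalityI subsetI)
    fix p assume p: "p \<in> carrier P"
    let ?d = "p \<ominus>\<^bsub>P\<^esub> s (u p)"
    have "?d \<in> carrier P" "\<theta> ?d = ?d" using split[OF p] fixed[of ?d] by (simp_all add: D_iff)
    then have "?d \<in> L" using L(2) by (metis imageI subsetD)
    moreover have "s (u p) \<in> ?X'" using X'(3) p by blast
    ultimately show "p \<in> L <+>\<^bsub>P\<^esub> ?X'" using split[OF p] by (subst P.mem_set_add) blast
  qed (rule P.submoduleD(1)[OF P.submodule_set_add(1)[OF P.delta_smallD(1)[OF L(1)] X'(1)]])
  ultimately have "?X' = carrier P" by (intro P.delta_smallD(2)[OF L(1) X'(1)])
  then have "k \<in> ?X'" using k(1) by simp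
  then obtain x q where x: "x \<in> X" "x \<in> ?D" and q: "q \<in> carrier P" and kx: "k = x \<oplus>\<^bsub>P\<^esub> s (u q)"
    unfolding P.mem_set_add by blast
  have "u k = \<zero>\<^bsub>P\<^esub>" using k by (simp add: u_def P.M.minus_eq P.M.r_neg)
  then have "u q = \<zero>\<^bsub>P\<^esub>"
    using x(2) q uD(1) sD(1) by (simp add: kx uD(2) usu D_iff)
  then have "k = x" using kx x(2) by (simp add: D_iff mod_hom_group(1)[OF P' P' s])
  then show "k \<in> X" using x(1) by simp
qed

text \<open>
  Let \<open>k\<close> be in the kernel \<open>K\<close> and let \<open>T\<close> be the set of nonzero coordinates of \<open>k\<close> in a dual basis.
  Purity gives \<open>k = \<Sum> \<kappa>\<^sub>t t\<close> with \<open>\<kappa>\<^sub>t \<in> K\<close>. Replacing each coefficient \<open>t\<close> by the coordinate function that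
  takes the value \<open>t\<close> at \<open>k\<close> turns this expression into an endomorphism \<open>\<theta>\<close> of \<open>P\<close> that fixes \<open>k\<close>, with
  image in the submodule generated by the \<open>\<kappa>\<^sub>t\<close>.
\<close>

lemma flat_kernel_in_singular_quotient_kernel:
  assumes P: "projective_module R P" and F: "flat_module R F" and h: "h \<in> mod_hom R P F"
    and Y: "submodule Y R F" "h ` carrier P \<inter> Y = {\<zero>\<^bsub>F\<^esub>}" "h ` carrier P <+>\<^bsub>F\<^esub> Y = carrier F"
    and K: "a_kernel P F h \<subseteq> delta_submodule R P"
    and X: "submodule X R P" "singular_module R (quot_module P X)"
  shows "a_kernel P F h \<subseteq> X"
proof
  fix k assume k: "k \<in> a_kernel P F h"
  have P': "right_module R P" using P by (simp add: projective_module_def)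
  have F': "right_module R F" using F by (simp add: flat_module_def)
  interpret P: right_module R P by (rule P')
  have kP: "k \<in> carrier P" using k by (simp add: mod_hom_kernel_image(3)[OF P' F' h])
  obtain \<sigma> where \<sigma>: "\<sigma> \<in> mod_hom R P (free_right_module R (carrier P))"
    and basis: "\<And>p. p \<in> carrier P \<Longrightarrow> (\<Oplus>\<^bsub>P\<^esub>q\<in>{q. \<sigma> p q \<noteq> \<zero>\<^bsub>R\<^esub>}. \<sigma> p q \<odot>\<^bsub>P\<^esub> q) = p"
    using projective_module_dual_basis[OF P] by blast
  have \<sigma>R: "\<sigma> p q \<in> carrier R" if "p \<in> carrier P" for p q
    using mod_homD(1)[OF \<sigma> that] by (auto simp: free_right_module_def)
  let ?S = "{q. \<sigma> k q \<noteq> \<zero>\<^bsub>R\<^esub>}"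
  have S: "finite ?S" "(\<lambda>q. q) \<in> ?S \<rightarrow> carrier P"
    using mod_homD(1)[OF \<sigma> kP] by (auto simp: free_right_module_def)
  define T where "T = \<sigma> k ` ?S"
  have T: "finite T" "T \<subseteq> carrier R" "\<sigma> k \<in> ?S \<rightarrow> T"
    unfolding T_def using S(1) \<sigma>R[OF kP] by auto
  obtain \<kappa> where \<kappa>: "\<kappa> \<in> T \<rightarrow> a_kernel P F h" and k_eq: "k = (\<Oplus>\<^bsub>P\<^esub>t\<in>T. t \<odot>\<^bsub>P\<^esub> \<kappa> t)"
    using flat_kernel_pure[OF P' F h Y T(1,2) S T(3)] k unfolding basis[OF kP] by blast
  have \<kappa>P: "\<kappa> t \<in> carrier P" if "t \<in> T" for t
    using \<kappa> that by (auto simp: mod_hom_kernel_image(3)[OF P' F' h] dest: funcset_mem)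
  have "\<kappa> ` T \<subseteq> delta_submodule R P" using \<kappa> K by auto
  then obtain L where L: "delta_small R P L" "\<kappa> ` T \<subseteq> L"
    using P.finite_subset_delta_submodule[of "\<kappa> ` T"] T(1) by blast
  note LD = P.submoduleD[OF P.delta_smallD(1)[OF L(1)]]
  define i where "i = inv_into ?S (\<sigma> k)"
  have i: "\<sigma> k (i t) = t" if "t \<in> T" for t
    using that unfolding T_def i_def by (rule f_inv_into_f)
  define \<theta> where "\<theta> p = (\<Oplus>\<^bsub>P\<^esub>t\<in>T. \<sigma> p (i t) \<odot>\<^bsub>P\<^esub> \<kappa> t)" for p
  have cl: "(\<lambda>t. \<sigma> p (i t) \<odot>\<^bsub>P\<^esub> \<kappa> t) \<in> T \<rightarrow> carrier P" if "p \<in> carrier P" for p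
    using \<sigma>R[OF that] \<kappa>P by auto
  have "\<theta> \<in> mod_hom R P P"
    unfolding mod_hom_def
  proof (intro CollectI conjI ballI)
    show "\<theta> \<in> carrier P \<rightarrow> carrier P" unfolding \<theta>_def using cl by (auto intro: P.M.finsum_closed)
    fix p assume p: "p \<in> carrier P"
    show "\<theta> (p \<oplus>\<^bsub>P\<^esub> q) = \<theta> p \<oplus>\<^bsub>P\<^esub> \<theta> q" if q: "q \<in> carrier P" for q
      unfolding \<theta>_def P.M.finsum_addf[OF cl[OF p] cl[OF q], symmetric]
      using p q \<sigma>R \<kappa>P mod_homD(2)[OF \<sigma> p q]
      by (intro P.M.finsum_cong') (auto simp: free_right_module_def P.smult_l_distr)
  next
    fix a p assume a: "a \<in> carrier R" and p: "p \<in> carrier P"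
    show "\<theta> (a \<odot>\<^bsub>P\<^esub> p) = a \<odot>\<^bsub>P\<^esub> \<theta> p"
      unfolding \<theta>_def P.smult_finsum[OF T(1) a cl[OF p]]
      using a p \<sigma>R \<kappa>P mod_homD(3)[OF \<sigma> a p]
      by (intro P.M.finsum_cong') (auto simp: free_right_module_def P.smult_assoc_right)
  qed
  moreover have "\<theta> ` carrier P \<subseteq> L"
  proof (intro image_subsetI)
    fix p assume "p \<in> carrier P"
    then show "\<theta> p \<in> L" unfolding \<theta>_def
      using L(2) \<sigma>R LD(6) by (intro P.submodule_finsum[OF P.delta_smallD(1)[OF L(1)] T(1)]) auto
  qed
  moreover have "\<theta> k = k"
  proof -
    have "\<theta> k = (\<Oplus>\<^bsub>P\<^esub>t\<in>T. t \<odot>\<^bsub>P\<^esub> \<kappa> t)"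
      unfolding \<theta>_def using i \<kappa>P T(2) by (intro P.M.finsum_cong') auto
    then show ?thesis using k_eq by simp
  qed
  ultimately show "k \<in> X"
    using fixed_point_in_singular_quotient_kernel[OF P _ L(1) _ kP _ X] by blast
qed

section \<open>Generalized projective \<open>\<delta>\<close>-covers\<close>

theorem theorem2p14:
  fixes R :: "('r, 'x) ring_scheme"
    and M :: "('r, 'm, 'y) module_scheme"
    and F :: "('r, 'f, 'z) module_scheme"
    and P :: "('r, 'p, 'w) module_scheme"
  assumes "ring R"
    and "right_module R M"
    and "flat_delta_cover R F M f"
    and "generalized_projective_delta_cover R P M g"
  shows "projective_delta_cover R P M g"
proof -
  have F: "flat_module R F" "right_module R F" and f: "f \<in> mod_epi R F M"
    and kf: "delta_small R F (a_kernel F M f)"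
    using assms(3) by (auto simp: flat_delta_cover_def delta_cover_def)
  have P: "projective_module R P" "right_module R P" and g: "g \<in> mod_epi R P M"
    and kg: "a_kernel P M g \<subseteq> delta_submodule R P"
    using assms(4) by (auto simp: generalized_projective_delta_cover_def projective_module_def)
  interpret P: right_module R P by (rule P(2))
  interpret F: right_module R F by (rule F(2))
  interpret M: right_module R M by fact
  have fh: "f \<in> mod_hom R F M" "f ` carrier F = carrier M"
    and gh: "g \<in> mod_hom R P M" "g ` carrier P = carrier M"
    using f g by (auto simp: mod_epi_def)
  note fD = mod_homD[OF fh(1)] and kf_iff = mod_hom_kernel_image(3)[OF F(2) assms(2) fh(1)]
  note gD = mod_homD[OF gh(1)] and kg_iff = mod_hom_kernel_image(3)[OF P(2) assms(2) gh(1)]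
  have "lifts_along R P F M" by (rule projective_module_lifts[OF P(1) F(2) assms(2)])
  then obtain h where h: "h \<in> mod_hom R P F" and h_lift: "\<And>p. p \<in> carrier P \<Longrightarrow> f (h p) = g p"
    using f gh(1) unfolding lifts_along_def by meson
  note hD = mod_homD[OF h] and kh_iff = mod_hom_kernel_image(3)[OF P(2) F(2) h]
  let ?H = "h ` carrier P"
  have "submodule (carrier P) R P" by (rule P.submoduleI) auto
  note H = mod_hom_kernel_image(2)[OF P(2) F(2) h this]
  have "carrier F \<subseteq> a_kernel F M f <+>\<^bsub>F\<^esub> ?H"
  proof
    fix x assume x: "x \<in> carrier F"
    then have "f x \<in> g ` carrier P" using fD(1) gh(2) by simp
    then obtain p where p: "p \<in> carrier P" "f x = g p" by blast
    note hp = hD(1)[OF p(1)]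
    have "f (x \<ominus>\<^bsub>F\<^esub> h p) = g p \<ominus>\<^bsub>M\<^esub> g p"
      using x hp p by (simp add: mod_hom_group(3)[OF F(2) assms(2) fh(1)] h_lift)
    then have "f (x \<ominus>\<^bsub>F\<^esub> h p) = \<zero>\<^bsub>M\<^esub>" using gD(1)[OF p(1)] by (simp add: M.M.minus_eq M.M.r_neg)
    then have "x \<ominus>\<^bsub>F\<^esub> h p \<in> a_kernel F M f" using x hp by (simp add: kf_iff)
    moreover have "x = (x \<ominus>\<^bsub>F\<^esub> h p) \<oplus>\<^bsub>F\<^esub> h p"
      using x hp by (simp add: F.M.minus_eq F.M.a_assoc F.M.l_neg)
    ultimately show "x \<in> a_kernel F M f <+>\<^bsub>F\<^esub> ?H" unfolding F.mem_set_add using p(1) by blast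
  qed
  then obtain Y where Y: "submodule Y R F" "?H \<inter> Y = {\<zero>\<^bsub>F\<^esub>}" "?H <+>\<^bsub>F\<^esub> Y = carrier F"
    by (rule F.delta_small_complement[OF kf H])
  note YD = F.submoduleD[OF Y(1)]
  have "f \<zero>\<^bsub>F\<^esub> = \<zero>\<^bsub>M\<^esub>" by (rule mod_hom_group(1)[OF F(2) assms(2) fh(1)])
  then have "a_kernel P F h \<subseteq> a_kernel P M g"
    using h_lift by (auto simp: kh_iff kg_iff) (metis h_lift)
  then have kh: "a_kernel P F h \<subseteq> delta_submodule R P" using kg by blast

  \<comment> \<open>\<open>\<delta>\<close>-smallness of \<open>Ker g\<close> is tested on \<open>X\<close> by transporting \<open>X\<close> to \<open>W = h(X) + Y\<close> in \<open>F\<close>.\<close>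
  have "X = carrier P" if X: "submodule X R P" "singular_module R (quot_module P X)"
    and sum: "a_kernel P M g <+>\<^bsub>P\<^esub> X = carrier P" for X
  proof -
    note XD = P.submoduleD[OF X(1)]
    have kX: "a_kernel P F h \<subseteq> X"
      by (rule flat_kernel_in_singular_quotient_kernel[OF P(1) F(1) h Y kh X])
    note hX = mod_hom_kernel_image(2)[OF P(2) F(2) h X(1)]
    let ?W = "h ` X <+>\<^bsub>F\<^esub> Y"
    note W = F.submodule_set_add[OF hX Y(1)]
    have "singular_module R (quot_module F ?W)"
      unfolding F.singular_quot_iff[OF W(1)]
    proof
      fix x assume "x \<in> carrier F"
      then obtain p y where p: "p \<in> carrier P" "y \<in> Y" "x = h p \<oplus>\<^bsub>F\<^esub> y"
        unfolding Y(3)[symmetric] F.mem_set_add by blast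
      obtain I where I: "essential_right_ideal I R" "\<forall>a\<in>I. a \<odot>\<^bsub>P\<^esub> p \<in> X"
        using X(2) p(1) unfolding P.singular_quot_iff[OF X(1)] by blast
      note IR = essential_right_ideal_carrier[OF I(1)]
      have "a \<odot>\<^bsub>F\<^esub> x \<in> ?W" if a: "a \<in> I" for a
      proof -
        have "a \<odot>\<^bsub>F\<^esub> x = h (a \<odot>\<^bsub>P\<^esub> p) \<oplus>\<^bsub>F\<^esub> a \<odot>\<^bsub>F\<^esub> y"
          using p IR[OF a] hD(1) YD(1) by (simp add: hD(3) F.smult_r_distr)
        moreover have "a \<odot>\<^bsub>P\<^esub> p \<in> X" "a \<odot>\<^bsub>F\<^esub> y \<in> Y" using I(2) a YD(6)[OF IR[OF a] p(2)] by auto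
        ultimately show ?thesis unfolding F.mem_set_add by blast
      qed
      then show "\<exists>I. essential_right_ideal I R \<and> (\<forall>a\<in>I. a \<odot>\<^bsub>F\<^esub> x \<in> ?W)" using I(1) by blast
    qed
    moreover have "a_kernel F M f <+>\<^bsub>F\<^esub> ?W = carrier F"
    proof (intro equalityI subsetI)
      fix x assume "x \<in> carrier F"
      then obtain p y where p: "p \<in> carrier P" "y \<in> Y" "x = h p \<oplus>\<^bsub>F\<^esub> y"
        unfolding Y(3)[symmetric] F.mem_set_add by blast
      obtain n z where n: "n \<in> a_kernel P M g" "z \<in> X" "p = n \<oplus>\<^bsub>P\<^esub> z"
        using p(1) unfolding sum[symmetric] P.mem_set_add by blast
      have nP: "n \<in> carrier P" "g n = \<zero>\<^bsub>M\<^esub>" using n(1) by (simp_all add: kg_iff)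
      have "h n \<in> a_kernel F M f" using nP hD(1) by (simp add: kf_iff h_lift)
      moreover have "h z \<oplus>\<^bsub>F\<^esub> y \<in> ?W" using n(2) p(2) unfolding F.mem_set_add by blast
      moreover have "x = h n \<oplus>\<^bsub>F\<^esub> (h z \<oplus>\<^bsub>F\<^esub> y)"
        using p n(2,3) nP(1) XD(1) YD(1) hD(1) by (simp add: hD(2) F.M.a_assoc)
      ultimately show "x \<in> a_kernel F M f <+>\<^bsub>F\<^esub> ?W" by (subst F.mem_set_add) blast
    qed (rule F.submoduleD(1)[OF F.submodule_set_add(1)[OF F.delta_smallD(1)[OF kf] W(1)]])
    ultimately have W_all: "?W = carrier F" by (rule F.delta_smallD(2)[OF kf W(1)])
    have "p \<in> X" if p: "p \<in> carrier P" for p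
    proof -
      have "h p \<in> ?W" using hD(1)[OF p] W_all by simp
      then obtain z y where z: "z \<in> X" "y \<in> Y" "h p = h z \<oplus>\<^bsub>F\<^esub> y"
        unfolding F.mem_set_add by blast
      have zP: "z \<in> carrier P" using z(1) XD(1) by simp
      have "h p \<oplus>\<^bsub>F\<^esub> \<zero>\<^bsub>F\<^esub> = h z \<oplus>\<^bsub>F\<^esub> y" using z(3) hD(1)[OF p] by simp
      then have "h p = h z"
        by (rule F.direct_sum_unique[OF H Y(1,2) imageI[OF p] imageI[OF zP] YD(2) z(2)])
      then have "h (p \<ominus>\<^bsub>P\<^esub> z) = h z \<ominus>\<^bsub>F\<^esub> h z"
        using p zP by (simp add: mod_hom_group(3)[OF P(2) F(2) h])
      then have "p \<ominus>\<^bsub>P\<^esub> z \<in> a_kernel P F h"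
        using p zP hD(1)[OF zP] by (simp add: kh_iff F.M.minus_eq F.M.r_neg)
      then have "(p \<ominus>\<^bsub>P\<^esub> z) \<oplus>\<^bsub>P\<^esub> z \<in> X" using kX XD(3)[OF _ z(1)] by blast
      then show ?thesis using p zP by (simp add: P.M.minus_eq P.M.a_assoc P.M.l_neg)
    qed
    then show ?thesis using XD(1) by blast
  qed
  then have "delta_small R P (a_kernel P M g)"
    unfolding delta_small_def
    using mod_hom_kernel_image(1)[OF P(2) assms(2) gh(1)] by blast
  then show ?thesis
    using P assms(2) g by (simp add: projective_delta_cover_def delta_cover_def)
qed

end
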